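(* Let $q>0$ and $h\in L^1_{loc}(\mathbb{R}^N)$. Then the problem $$-\mathrm{div}\left(\frac{\nabla u}{\sqrt{1+|\nabla u|^2}}\right)+|u|^{q-1}u=h\quad\text{on }\mathbb{R}^N$$ has at most one weak solution $v\in W^{1,1}_{loc}(\mathbb{R}^N)\cap L^q_{loc}(\mathbb{R}^N)$. Moreover, any such weak solution $v$ satisfies $$\inf_{\mathbb{R}^N}h\le |v|^{q-1}v\le\sup_{\mathbb{R}^N}h\quad\text{a.e. on }\mathbb{R}^N .$$
   Context: $C^1_0(\mathbb{R}^N)$ denotes compactly supported $C^1$ functions. A function $u\in W^{1,1}_{loc}(\mathbb{R}^N)\cap L^q_{loc}(\mathbb{R}^N)$ is a weak solution if $\int_{\mathbb{R}^N}\frac{\nabla u\cdot\nabla\phi}{\sqrt{1+|\nabla u|^2}}+\int_{\mathbb{R}^N}|u|^{q-1}u\,\phi=\int_{\mathbb{R}^N}h\phi$ for every $\phi\in C^1_0(\mathbb{R}^N)$. $|u|^{q-1}u$ is read as $0$ where $u=0$. $\inf$ and $\sup$ of $h$ are essential infimum and supremum, possibly $-\infty$, $+\infty$. *)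

theory Defs
  imports "HOL-Analysis.Analysis" "HOL-Probability.Essential_Supremum"
begin

definition Lp_loc :: "real \<Rightarrow> ('a::euclidean_space \<Rightarrow> 'b::euclidean_space) set" where
  "Lp_loc p = {f \<in> borel_measurable lebesgue.
     \<forall>K. compact K \<longrightarrow> set_integrable lebesgue K (\<lambda>x. norm (f x) powr p)}"

definition grad :: "('a::euclidean_space \<Rightarrow> real) \<Rightarrow> 'a \<Rightarrow> 'a" where
  "grad \<phi> x = (THE D. GDERIV \<phi> x :> D)"

definition C1_0 :: "('a::euclidean_space \<Rightarrow> real) set" where
  "C1_0 = {\<phi>. (\<forall>x. \<phi> differentiable (at x)) \<and> continuous_on UNIV (grad \<phi>) \<and>
     compact (closure (support_on UNIV \<phi>))}"

text \<open>Weak gradients are tested against compactly supported \<open>C\<^sup>1\<close> functions, as in Gilbarg and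
  Trudinger, \<^emph>\<open>Elliptic Partial Differential Equations of Second Order\<close>, Section 7.3. The
  identity is vector-valued: its \<open>i\<close>-th component is the usual one for the \<open>i\<close>-th partial
  derivative.\<close>

definition is_weak_grad :: "('a::euclidean_space \<Rightarrow> real) \<Rightarrow> ('a \<Rightarrow> 'a) \<Rightarrow> bool" where
  "is_weak_grad u g \<longleftrightarrow> g \<in> Lp_loc 1 \<and>
     (\<forall>\<phi>\<in>C1_0. (LINT x|lebesgue. u x *\<^sub>R grad \<phi> x) = - (LINT x|lebesgue. \<phi> x *\<^sub>R g x))"

definition W11_loc :: "('a::euclidean_space \<Rightarrow> real) set" where
  "W11_loc = {u \<in> Lp_loc 1. \<exists>g. is_weak_grad u g}"

text \<open>A weak gradient is only determined almost everywhere; any representative is chosen.\<close>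

definition weak_grad :: "('a::euclidean_space \<Rightarrow> real) \<Rightarrow> 'a \<Rightarrow> 'a" where
  "weak_grad u = (SOME g. is_weak_grad u g)"

text \<open>\<open>signed_pow q t\<close> is \<open>|t|\<^bsup>q-1\<^esup> t\<close>. It is \<open>0\<close> at \<open>t = 0\<close> for every \<open>q\<close>, because
  \<open>0 powr a = 0\<close>.\<close>

definition signed_pow :: "real \<Rightarrow> real \<Rightarrow> real" where
  "signed_pow q t = \<bar>t\<bar> powr (q - 1) * t"

definition weak_solution ::
    "real \<Rightarrow> ('a::euclidean_space \<Rightarrow> real) \<Rightarrow> ('a \<Rightarrow> real) \<Rightarrow> bool" where
  "weak_solution q h u \<longleftrightarrow> u \<in> W11_loc \<inter> Lp_loc q \<and>
     (\<forall>\<phi>\<in>C1_0.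
        (LINT x|lebesgue. (weak_grad u x \<bullet> grad \<phi> x) / sqrt (1 + (norm (weak_grad u x))\<^sup>2))
        + (LINT x|lebesgue. signed_pow q (u x) * \<phi> x)
        = (LINT x|lebesgue. h x * \<phi> x))"

definition essinf :: "'a measure \<Rightarrow> ('a \<Rightarrow> ereal) \<Rightarrow> ereal" where
  "essinf M f = - esssup M (\<lambda>x. - f x)"

end

theory Submission
  imports Defs
begin

text \<open>
  Uniqueness and the two bounds all follow from a comparison principle: if \<open>u\<close> and \<open>v\<close> solve the
  equation with right-hand sides \<open>h\<^sub>1 \<le> h\<^sub>2\<close> then \<open>u \<le> v\<close>; constants are solutions, which gives the
  bounds. Write \<open>s(t) = |t|\<^bsup>q-1\<^esup> t\<close>, \<open>a(p) = p / sqrt (1 + |p|\<^sup>2)\<close>, and subtract the equations,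
  tested with \<open>T(S(u) - S(v)) \<phi>\<close>, where \<open>S\<close> is increasing with \<open>S' = \<rho>\<close>, \<open>T\<close> is bounded and vanishes
  to order \<open>k\<close> at \<open>0\<close>, and \<open>\<phi>\<close> is a cutoff at scale \<open>R = \<epsilon>\<^bsup>-2\<^esup>\<close>.

  For \<open>q \<ge> 1\<close> one takes \<open>S(t) = t\<close>. For \<open>q < 1\<close> the difference \<open>s(u) - s(v)\<close> does not control
  \<open>u - v\<close> when both are large, and \<open>S\<close> has to flatten at infinity like \<open>s\<close>:
  \<open>\<rho>(t) = (M + t\<^sup>2)\<^bsup>(q-1)/2\<^esup>\<close>. The price is that \<open>(a(\<xi>) - a(\<eta>)) \<bullet> (\<rho>(u) \<xi> - \<rho>(v) \<eta>)\<close> need not be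
  nonnegative; expressed through the unit normals of the graphs it is at least
  \<open>- (\<rho>(u) - \<rho>(v))\<^sup>2 / (2 (\<rho>(u) + \<rho>(v)))\<close>. Since \<open>sqrt \<rho>\<close> is a Lipschitz function of \<open>S\<close>, with a
  small constant for large \<open>M\<close>, this is absorbed by the zero-order term. In both cases
  \<open>S(u) - S(v) \<le> C (s(u) - s(v))\<^bsup>\<theta>\<^esup>\<close> with \<open>\<theta> = min 1 (1/q)\<close>.

  Since \<open>a\<close> is bounded and \<open>|\<nabla>\<phi>| \<le> \<epsilon> \<phi> + O(\<epsilon>\<^bsup>m+1\<^esup>)\<close>, the flux term is at most \<open>2 \<epsilon> T \<phi>\<close> up to a
  small error. Where \<open>s(u) - s(v) \<ge> 8 \<epsilon>\<close> it is absorbed, and elsewhere \<open>T = O(\<epsilon>\<^bsup>\<theta>k\<^esup>)\<close> beats the volume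
  \<open>\<epsilon>\<^bsup>-2N\<^esup>\<close> of the support. Letting \<open>\<epsilon> \<rightarrow> 0\<close> gives \<open>\<integral> (s(u) - s(v)) T(S(u) - S(v)) = 0\<close>.
  The nonlinear test function is justified by mollifying \<open>u\<close> and \<open>v\<close>.
\<close>

subsection \<open>\<open>C\<^sup>1\<close> functions and their gradients\<close>

definition is_C1 :: "('a::euclidean_space \<Rightarrow> real) \<Rightarrow> bool" where
  "is_C1 f \<longleftrightarrow> (\<forall>x. f differentiable (at x)) \<and> continuous_on UNIV (grad f)"

lemma grad_eqI:
  assumes "GDERIV f x :> D" shows "grad f x = D"
  unfolding grad_def
proof (rule the_equality[where P = "\<lambda>D. GDERIV f x :> D", OF assms])
  fix E assume "GDERIV f x :> E"
  with assms have "(\<lambda>h. h \<bullet> D) = (\<lambda>h. h \<bullet> E)"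
    unfolding gderiv_def using has_derivative_unique by blast
  then show "E = D"
    by (metis inner_commute vector_eq_rdot)
qed

lemma differentiable_imp_GDERIV_grad:
  assumes "f differentiable (at x)" shows "GDERIV f x :> grad f x"
proof -
  obtain f' where f'_derivative: "(f has_derivative f') (at x)"
    using assms by (auto simp: differentiable_def)
  have "f' = (\<lambda>h. h \<bullet> adjoint f' 1)"
    using adjoint_works[OF has_derivative_linear[OF f'_derivative], of _ 1]
    by (simp add: fun_eq_iff)
  with f'_derivative have "GDERIV f x :> adjoint f' 1"
    by (simp add: gderiv_def)
  then show ?thesis
    using grad_eqI by metis
qed

lemma is_C1I:
  assumes "\<And>x. GDERIV f x :> D x" "continuous_on UNIV D"
  shows "is_C1 f" "grad f = D"
proof -
  show "grad f = D"
    using grad_eqI[OF assms(1)] by blast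
  then show "is_C1 f"
    using assms by (auto simp: is_C1_def gderiv_def differentiable_def)
qed

lemma is_C1_GDERIV: "is_C1 f \<Longrightarrow> GDERIV f x :> grad f x"
  by (simp add: is_C1_def differentiable_imp_GDERIV_grad)

lemma is_C1_continuous_grad: "is_C1 f \<Longrightarrow> continuous_on UNIV (grad f)"
  by (simp add: is_C1_def)

lemma is_C1_continuous: "is_C1 f \<Longrightarrow> continuous_on UNIV f"
  unfolding is_C1_def
  by (simp add: continuous_on_eq_continuous_at differentiable_imp_continuous_within)

lemma is_C1_const: "is_C1 (\<lambda>x. c)" and grad_const: "grad (\<lambda>x. c) = (\<lambda>x. 0)"
  using is_C1I[of "\<lambda>x. c" "\<lambda>x. 0"] by (simp_all add: GDERIV_const)

lemma is_C1_diff: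
  assumes "is_C1 f" "is_C1 g"
  shows "is_C1 (\<lambda>x. f x - g x)" "grad (\<lambda>x. f x - g x) = (\<lambda>x. grad f x - grad g x)"
  using is_C1I[of "\<lambda>x. f x - g x" "\<lambda>x. grad f x - grad g x"] assms
  by (simp_all add: GDERIV_diff is_C1_GDERIV continuous_on_diff is_C1_continuous_grad)

lemma is_C1_mult:
  assumes "is_C1 f" "is_C1 g"
  shows "is_C1 (\<lambda>x. f x * g x)"
    "grad (\<lambda>x. f x * g x) = (\<lambda>x. f x *\<^sub>R grad g x + g x *\<^sub>R grad f x)"
  using is_C1I[of "\<lambda>x. f x * g x" "\<lambda>x. f x *\<^sub>R grad g x + g x *\<^sub>R grad f x"] assms
  by (simp_all add: GDERIV_mult is_C1_GDERIV continuous_on_add continuous_on_scaleR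
      is_C1_continuous_grad is_C1_continuous)

lemma is_C1_compose:
  assumes "is_C1 f" "\<And>t. (T has_real_derivative T' t) (at t)" "continuous_on UNIV T'"
  shows "is_C1 (\<lambda>x. T (f x))" "grad (\<lambda>x. T (f x)) = (\<lambda>x. T' (f x) *\<^sub>R grad f x)"
  using is_C1I[of "\<lambda>x. T (f x)" "\<lambda>x. T' (f x) *\<^sub>R grad f x"] assms
  by (simp_all add: GDERIV_DERIV_compose is_C1_GDERIV continuous_on_scaleR
      is_C1_continuous_grad is_C1_continuous continuous_on_compose2[OF assms(3)])

lemma is_C1_reflect:
  fixes f :: "'a::euclidean_space \<Rightarrow> real"
  assumes "is_C1 f"
  shows "is_C1 (\<lambda>y. f (x - y))" "grad (\<lambda>y. f (x - y)) = (\<lambda>y. - grad f (x - y))"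
proof -
  have "GDERIV (\<lambda>y. f (x - y)) y :> - grad f (x - y)" for y
  proof -
    have "((\<lambda>y. x - y) has_derivative (\<lambda>h. - h)) (at y)"
      by (auto intro!: derivative_eq_intros)
    from has_derivative_compose[OF this is_C1_GDERIV[OF assms, unfolded gderiv_def]]
    show ?thesis
      by (simp add: gderiv_def)
  qed
  moreover have "continuous_on UNIV (\<lambda>y. - grad f (x - y))"
    by (intro continuous_intros continuous_on_compose2[OF is_C1_continuous_grad[OF assms]]) auto
  ultimately show "is_C1 (\<lambda>y. f (x - y))" "grad (\<lambda>y. f (x - y)) = (\<lambda>y. - grad f (x - y))"
    by (rule is_C1I)+
qed

lemma C1_0_iff_bounded_support: "f \<in> C1_0 \<longleftrightarrow> is_C1 f \<and> bounded {x. f x \<noteq> 0}"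
  by (simp add: C1_0_def is_C1_def support_on_def)

lemma grad_eq_0_outside_closed:
  assumes "closed K" "\<And>x. x \<notin> K \<Longrightarrow> f x = 0" "x \<notin> K"
  shows "grad f x = 0"
proof (rule grad_eqI)
  have "(f has_derivative (\<lambda>h. 0)) (at x)"
    by (rule has_derivative_transform_within_open[OF has_derivative_const[of 0], of "- K"])
      (use assms in auto)
  then show "GDERIV f x :> 0"
    by (simp add: gderiv_def)
qed

definition C1_supported_in :: "'a::euclidean_space set \<Rightarrow> ('a \<Rightarrow> real) set" where
  "C1_supported_in B = {f. is_C1 f \<and> (\<forall>x. x \<notin> B \<longrightarrow> f x = 0)}"

lemma C1_supported_in_is_C1: "f \<in> C1_supported_in B \<Longrightarrow> is_C1 f"
  by (simp add: C1_supported_in_def)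

lemma C1_supported_in_eq_0: "f \<in> C1_supported_in B \<Longrightarrow> x \<notin> B \<Longrightarrow> f x = 0"
  by (simp add: C1_supported_in_def)

lemma C1_supported_in_grad_eq_0: "f \<in> C1_supported_in B \<Longrightarrow> closed B \<Longrightarrow> x \<notin> B \<Longrightarrow> grad f x = 0"
  using grad_eq_0_outside_closed C1_supported_in_eq_0 by blast

lemma C1_supported_in_C1_0:
  assumes "f \<in> C1_supported_in B" "bounded B" shows "f \<in> C1_0"
  using assms bounded_subset[of B "{x. f x \<noteq> 0}"]
  by (auto simp: C1_supported_in_def C1_0_iff_bounded_support)

lemma continuous_vanishing_outside_compact_bounded:
  fixes f :: "'a::topological_space \<Rightarrow> 'b::real_normed_vector"
  assumes "continuous_on K f" "compact K" "\<And>x. x \<notin> K \<Longrightarrow> f x = 0"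
  obtains L where "0 < L" "\<And>x. norm (f x) \<le> L"
proof -
  have "bounded (f ` K)"
    using assms(1,2) by (intro compact_imp_bounded compact_continuous_image)
  then obtain L where L_bound: "0 < L" "\<And>x. x \<in> K \<Longrightarrow> norm (f x) \<le> L"
    unfolding bounded_pos by blast
  have "norm (f x) \<le> L" for x
    using L_bound assms(3)[of x] by (cases "x \<in> K") auto
  with that L_bound(1) show thesis
    by blast
qed

lemma C1_supported_in_compact_bounds:
  assumes supported: "f \<in> C1_supported_in K" and compact_K: "compact K"
  obtains L where "0 < L" "\<And>x. \<bar>f x\<bar> \<le> L" "\<And>x. norm (grad f x) \<le> L"
proof -
  note C1 = C1_supported_in_is_C1[OF supported]
  obtain A where A_bound: "0 < A" "\<And>x. norm (f x) \<le> A"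
    using continuous_vanishing_outside_compact_bounded[OF _ compact_K, of f]
      continuous_on_subset[OF is_C1_continuous[OF C1]] C1_supported_in_eq_0[OF supported] by blast
  obtain B where B_bound: "0 < B" "\<And>x. norm (grad f x) \<le> B"
    using continuous_vanishing_outside_compact_bounded[OF _ compact_K, of "grad f"]
      continuous_on_subset[OF is_C1_continuous_grad[OF C1]]
      C1_supported_in_grad_eq_0[OF supported compact_imp_closed[OF compact_K]] by blast
  have "\<bar>f x\<bar> \<le> max A B" "norm (grad f x) \<le> max A B" for x
    using A_bound(2)[of x] B_bound(2)[of x] by auto
  with that[of "max A B"] A_bound(1) show thesis
    by simp
qed

lemma is_C1_imp_lipschitz:
  assumes "is_C1 f" "\<And>x. norm (grad f x) \<le> L"
  shows "\<bar>f a - f b\<bar> \<le> L * norm (a - b)"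
proof -
  have "norm (f a - f b) \<le> L * norm (a - b)"
  proof (rule differentiable_bound[of UNIV])
    fix x show "(f has_derivative (\<lambda>h. h \<bullet> grad f x)) (at x within UNIV)"
      using is_C1_GDERIV[OF assms(1), of x] by (simp add: gderiv_def)
    show "onorm (\<lambda>h. h \<bullet> grad f x) \<le> L"
    proof (rule onorm_le)
      fix h show "norm (h \<bullet> grad f x) \<le> L * norm h"
        using Cauchy_Schwarz_ineq2[of h "grad f x"] mult_left_mono[OF assms(2)[of x], of "norm h"]
        by (simp add: mult.commute)
    qed
  qed auto
  then show ?thesis by simp
qed

lemma DERIV_max_0_power:
  fixes t :: real
  assumes "2 \<le> m"
  shows "((\<lambda>t. (max 0 t) ^ m) has_real_derivative real m * (max 0 t) ^ (m - 1)) (at t)"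
proof -
  consider "t < 0" | "t > 0" | "t = 0" by linarith
  then show ?thesis
  proof cases
    assume "t < 0"
    have "((\<lambda>t. (max 0 t) ^ m) has_real_derivative 0) (at t)"
      by (rule has_field_derivative_transform_within_open[of "\<lambda>_. 0" 0 t "{..<0}"])
        (use \<open>t < 0\<close> assms in \<open>auto simp: max_def\<close>)
    then show ?thesis
      using \<open>t < 0\<close> assms by (simp add: max_def power_0_left)
  next
    assume "t > 0"
    have "((\<lambda>t. t ^ m) has_real_derivative real m * t ^ (m - 1)) (at t)"
      by (auto intro!: derivative_eq_intros)
    then have "((\<lambda>t. (max 0 t) ^ m) has_real_derivative real m * t ^ (m - 1)) (at t)"
      by (rule has_field_derivative_transform_within_open[of _ _ t "{0<..}"])
        (use \<open>t > 0\<close> in \<open>auto simp: max_def\<close>)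
    then show ?thesis
      using \<open>t > 0\<close> by (simp add: max_def)
  next
    assume "t = 0"
    have "((\<lambda>h::real. (max 0 h) ^ (m - 1)) \<longlongrightarrow> (max 0 0) ^ (m - 1)) (at 0)"
      by (intro tendsto_intros)
    moreover have "(max 0 h) ^ (m - 1) = (max 0 h) ^ m / h" if "h \<noteq> 0" for h :: real
      using assms that power_minus_mult[of m h]
      by (cases "0 < h") (auto simp: field_simps power_0_left)
    ultimately have "((\<lambda>h::real. (max 0 h) ^ m / h) \<longlongrightarrow> 0) (at 0)"
      using assms by (subst Lim_cong_within[where g = "\<lambda>h. (max 0 h) ^ (m - 1)"])
        (auto simp: power_0_left)
    then show ?thesis
      using \<open>t = 0\<close> assms by (simp add: has_field_derivative_iff power_0_left)
  qed
qed

definition cutoff :: "nat \<Rightarrow> real \<Rightarrow> 'a::euclidean_space \<Rightarrow> real" where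
  "cutoff m R x = (max 0 (1 - (norm x / R)\<^sup>2)) ^ m"

lemma is_C1_cutoff:
  assumes "2 \<le> m"
  shows "is_C1 (cutoff m R :: 'a::euclidean_space \<Rightarrow> real)"
    "grad (cutoff m R :: 'a \<Rightarrow> real) =
      (\<lambda>x. - (2 * real m / R\<^sup>2 * (max 0 (1 - (norm x / R)\<^sup>2)) ^ (m - 1)) *\<^sub>R x)"
proof -
  have "GDERIV (\<lambda>x::'a. 1 - (norm x / R)\<^sup>2) x :> - (2 / R\<^sup>2) *\<^sub>R x" for x :: 'a
    unfolding gderiv_def power_divide power2_norm_eq_inner
    by (cases "R = 0")
      (auto intro!: derivative_eq_intros simp: inner_commute fun_eq_iff field_simps
          power2_eq_square)
  from GDERIV_DERIV_compose[OF this DERIV_max_0_power[OF assms]]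
  have deriv: "GDERIV (cutoff m R) x :>
      - (2 * real m / R\<^sup>2 * (max 0 (1 - (norm x / R)\<^sup>2)) ^ (m - 1)) *\<^sub>R x" for x :: 'a
    unfolding cutoff_def by (simp add: mult_ac)
  have cont: "continuous_on UNIV
      (\<lambda>x::'a. - (2 * real m / R\<^sup>2 * (max 0 (1 - (norm x / R)\<^sup>2)) ^ (m - 1)) *\<^sub>R x)"
    by (cases "R = 0") (auto intro!: continuous_intros)
  show "is_C1 (cutoff m R :: 'a \<Rightarrow> real)"
    "grad (cutoff m R :: 'a \<Rightarrow> real) =
      (\<lambda>x. - (2 * real m / R\<^sup>2 * (max 0 (1 - (norm x / R)\<^sup>2)) ^ (m - 1)) *\<^sub>R x)"
    using is_C1I[OF deriv cont] by auto
qed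

lemma cutoff_nonneg: "0 \<le> cutoff m R x"
  by (simp add: cutoff_def)

lemma cutoff_le_1: "cutoff m R x \<le> 1"
  unfolding cutoff_def by (rule power_le_one) auto

lemma cutoff_pos: "0 < R \<Longrightarrow> norm x < R \<Longrightarrow> 0 < cutoff m R x"
  by (simp add: cutoff_def power_less_one_iff abs_square_less_1)

lemma cutoff_supported:
  assumes "0 < R" "2 \<le> m"
  shows "(cutoff m R :: 'a::euclidean_space \<Rightarrow> real) \<in> C1_supported_in (cball 0 R)"
proof -
  have "cutoff m R x = 0" if "x \<notin> cball 0 R" for x :: 'a
  proof -
    have "1 \<le> (norm x / R)\<^sup>2" using assms(1) that by (intro one_le_power) auto
    then show ?thesis using assms(2) by (simp add: cutoff_def max_def zero_power)
  qed
  then show ?thesis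
    using is_C1_cutoff(1)[OF assms(2)] by (simp add: C1_supported_in_def)
qed

lemma norm_grad_cutoff_le:
  fixes x :: "'a::euclidean_space"
  assumes m_ge_2: "2 \<le> m" and R_pos: "0 < R" and \<epsilon>_pos: "0 < \<epsilon>"
  shows "norm (grad (cutoff m R) x) \<le> \<epsilon> * (cutoff m R x + (2 * real m / (\<epsilon> * R)) ^ m)"
proof (cases "x \<in> cball 0 R")
  case False
  then have "grad (cutoff m R) x = 0"
    by (rule C1_supported_in_grad_eq_0[OF cutoff_supported[OF R_pos m_ge_2] closed_cball])
  then show ?thesis
    using cutoff_nonneg[of m R x] R_pos \<epsilon>_pos by simp
next
  case True
  define y where "y = max 0 (1 - (norm x / R)\<^sup>2)"
  define a where "a = 2 * real m / (\<epsilon> * R)"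
  have y_nonneg: "0 \<le> y" and a_nonneg: "0 \<le> a" and m_Suc: "m = Suc (m - 1)"
    using m_ge_2 R_pos \<epsilon>_pos by (simp_all add: y_def a_def)
  have "norm (grad (cutoff m R) x) = 2 * real m / R\<^sup>2 * y ^ (m - 1) * norm x"
    using y_nonneg by (simp add: is_C1_cutoff(2)[OF m_ge_2] y_def[symmetric])
  also have "\<dots> \<le> 2 * real m / R\<^sup>2 * y ^ (m - 1) * R"
    using True y_nonneg by (intro mult_left_mono) auto
  also have "\<dots> = \<epsilon> * (a * y ^ (m - 1))"
    using R_pos \<epsilon>_pos by (simp add: a_def power2_eq_square)
  also have "a * y ^ (m - 1) \<le> y ^ m + a ^ m"
  proof (cases "a \<le> y")
    case True
    then have "a * y ^ (m - 1) \<le> y * y ^ (m - 1)" using y_nonneg by (intro mult_right_mono) auto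
    then show ?thesis using a_nonneg by (subst m_Suc) (simp add: add_increasing2)
  next
    case False
    then have "a * y ^ (m - 1) \<le> a * a ^ (m - 1)"
      using y_nonneg a_nonneg by (intro mult_left_mono power_mono) auto
    then show ?thesis using y_nonneg by (subst m_Suc) (simp add: add_increasing)
  qed
  finally show ?thesis
    using \<epsilon>_pos by (simp add: cutoff_def y_def a_def)
qed

subsection \<open>Convergence in \<open>L\<^sup>1\<close>\<close>

lemma integrable_bounded_bilinear:
  fixes prod :: "'b::{real_normed_vector, second_countable_topology} \<Rightarrow>
      'c::{banach, second_countable_topology} \<Rightarrow> 'd::{banach, second_countable_topology}"
  assumes bilinear: "bounded_bilinear prod"
    and bounded_g: "g \<in> borel_measurable M" "\<And>x. norm (g x) \<le> C" and integrable_f: "integrable M f"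
  shows "integrable M (\<lambda>x. prod (g x) (f x))"
proof -
  obtain K where K_bound: "0 < K" "\<And>a b. norm (prod a b) \<le> norm a * norm b * K"
    using bounded_bilinear.pos_bounded[OF bilinear] by blast
  show ?thesis
  proof (rule Bochner_Integration.integrable_bound)
    show "integrable M (\<lambda>x. C * norm (f x) * K)"
      using integrable_f by simp
    have "continuous_on UNIV (\<lambda>p. prod (fst p) (snd p))"
      by (intro bounded_bilinear.continuous_on[OF bilinear] continuous_intros)
    then show "(\<lambda>x. prod (g x) (f x)) \<in> borel_measurable M"
      by (rule borel_measurable_continuous_Pair[OF bounded_g(1)
          borel_measurable_integrable[OF integrable_f]])
    show "AE x in M. norm (prod (g x) (f x)) \<le> norm (C * norm (f x) * K)"
    proof (rule AE_I2)
      fix x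
      have "norm (prod (g x) (f x)) \<le> norm (g x) * norm (f x) * K" by (rule K_bound)
      also have "\<dots> \<le> C * norm (f x) * K"
        using bounded_g(2)[of x] K_bound(1) by (intro mult_right_mono) auto
      finally show "norm (prod (g x) (f x)) \<le> norm (C * norm (f x) * K)" by simp
    qed
  qed
qed

definition L1_tendsto ::
    "'a measure \<Rightarrow> (nat \<Rightarrow> 'a \<Rightarrow> 'b::{banach, second_countable_topology}) \<Rightarrow> ('a \<Rightarrow> 'b) \<Rightarrow> bool" where
  "L1_tendsto M F f \<longleftrightarrow> (\<forall>n. integrable M (F n)) \<and> integrable M f \<and>
     (\<lambda>n. \<integral>x. norm (F n x - f x) \<partial>M) \<longlonglongrightarrow> 0"

lemma L1_tendsto_integrable:
  assumes "L1_tendsto M F f" shows "integrable M (F n)" "integrable M f"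
  using assms by (auto simp: L1_tendsto_def)

lemma L1_tendstoI_bound:
  assumes "\<And>n. integrable M (F n)" "integrable M f" "\<And>n. integrable M (D n)"
    and "\<And>n x. norm (F n x - f x) \<le> D n x" "(\<lambda>n. \<integral>x. D n x \<partial>M) \<longlonglongrightarrow> 0"
  shows "L1_tendsto M F f"
proof -
  have "(\<lambda>n. \<integral>x. norm (F n x - f x) \<partial>M) \<longlonglongrightarrow> 0"
  proof (rule Lim_null_comparison[OF always_eventually assms(5)])
    show "\<forall>n. norm (\<integral>x. norm (F n x - f x) \<partial>M) \<le> (\<integral>x. D n x \<partial>M)"
      using assms(1-4) by (auto intro!: integral_mono)
  qed
  with assms(1,2) show ?thesis
    by (simp add: L1_tendsto_def)
qed

lemma L1_tendsto_const: "integrable M f \<Longrightarrow> L1_tendsto M (\<lambda>n. f) f"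
  by (simp add: L1_tendsto_def)

lemma L1_tendsto_dominated:
  assumes measurable_F: "\<And>n. F n \<in> borel_measurable M" "f \<in> borel_measurable M"
    and integrable_w: "integrable M w"
    and lim: "AE x in M. (\<lambda>n. F n x) \<longlonglongrightarrow> f x" and bound: "\<And>n. AE x in M. norm (F n x) \<le> w x"
  shows "L1_tendsto M F f"
proof -
  note integrable = integrable_dominated_convergence[OF measurable_F(2,1) integrable_w lim bound]
    integrable_dominated_convergence2[OF measurable_F(2,1) integrable_w lim bound]
  have "(\<lambda>n. \<integral>x. norm (F n x - f x) \<partial>M) \<longlonglongrightarrow> (\<integral>x. 0 \<partial>M)"
  proof (rule integral_dominated_convergence)
    show "AE x in M. (\<lambda>n. norm (F n x - f x)) \<longlonglongrightarrow> 0"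
      using lim by eventually_elim (auto intro!: tendsto_norm_zero LIM_zero)
    show "AE x in M. norm (norm (F n x - f x)) \<le> w x + norm (f x)" for n
      using bound[of n] by eventually_elim (auto intro: norm_triangle_le_diff)
  qed (use integrable integrable_w in auto)
  then show ?thesis
    using integrable by (simp add: L1_tendsto_def)
qed

lemma L1_tendsto_integral:
  assumes "L1_tendsto M F f" shows "(\<lambda>n. \<integral>x. F n x \<partial>M) \<longlonglongrightarrow> (\<integral>x. f x \<partial>M)"
proof (rule LIM_zero_cancel, rule Lim_null_comparison[OF always_eventually])
  show "\<forall>n. norm ((\<integral>x. F n x \<partial>M) - (\<integral>x. f x \<partial>M)) \<le> (\<integral>x. norm (F n x - f x) \<partial>M)"
    using L1_tendsto_integrable[OF assms]
    by (auto simp flip: Bochner_Integration.integral_diff intro: integral_norm_bound)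
qed (use assms in \<open>simp add: L1_tendsto_def\<close>)

lemma L1_tendsto_subseq:
  assumes "L1_tendsto M F f" "strict_mono s" shows "L1_tendsto M (\<lambda>n. F (s n)) f"
  using assms LIMSEQ_subseq_LIMSEQ[OF _ assms(2), of _ 0] by (auto simp: L1_tendsto_def o_def)

lemma L1_tendsto_add:
  assumes F_tendsto: "L1_tendsto M F f" and G_tendsto: "L1_tendsto M G g"
  shows "L1_tendsto M (\<lambda>n x. F n x + G n x) (\<lambda>x. f x + g x)"
proof (rule L1_tendstoI_bound)
  note integrable = L1_tendsto_integrable[OF F_tendsto] L1_tendsto_integrable[OF G_tendsto]
  show "(\<lambda>n. \<integral>x. norm (F n x - f x) + norm (G n x - g x) \<partial>M) \<longlonglongrightarrow> 0"
    using tendsto_add_zero[of _ sequentially] F_tendsto G_tendsto integrable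
    by (simp add: L1_tendsto_def)
  show "norm (F n x + G n x - (f x + g x)) \<le> norm (F n x - f x) + norm (G n x - g x)" for n x
    by (simp add: add_diff_add norm_triangle_ineq)
qed (use L1_tendsto_integrable[OF F_tendsto] L1_tendsto_integrable[OF G_tendsto] in auto)

lemma L1_tendsto_diff:
  assumes "L1_tendsto M F f" "L1_tendsto M G g"
  shows "L1_tendsto M (\<lambda>n x. F n x - G n x) (\<lambda>x. f x - g x)"
proof -
  have "L1_tendsto M (\<lambda>n x. - G n x) (\<lambda>x. - g x)"
    using assms(2) by (simp add: L1_tendsto_def norm_minus_commute)
  from L1_tendsto_add[OF assms(1) this] show ?thesis by simp
qed

lemma norm_bilinear_diff_le:
  fixes a a' :: "'b::real_normed_vector" and b b' :: "'c::real_normed_vector"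
    and prod :: "'b \<Rightarrow> 'c \<Rightarrow> 'd::real_normed_vector"
  assumes bilinear: "bounded_bilinear prod"
    and K_bound: "0 < K" "\<And>a b. norm (prod a b) \<le> norm a * norm b * K" and "norm a \<le> C"
  shows "norm (prod a b - prod a' b') \<le> (C * norm (b - b') + norm (a - a') * norm b') * K"
proof -
  have "prod a b - prod a' b' = prod a (b - b') + prod (a - a') b'"
    by (simp add: bounded_bilinear.diff_left[OF bilinear] bounded_bilinear.diff_right[OF bilinear])
  also have "norm \<dots> \<le> norm a * norm (b - b') * K + norm (a - a') * norm b' * K"
    by (intro norm_triangle_le add_mono K_bound)
  also have "\<dots> \<le> C * norm (b - b') * K + norm (a - a') * norm b' * K"
    using assms by (intro add_right_mono mult_right_mono) auto
  finally show ?thesis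
    by (simp add: algebra_simps)
qed

lemma L1_tendsto_bounded_bilinear:
  fixes prod :: "'b::{banach, second_countable_topology} \<Rightarrow>
      'c::{banach, second_countable_topology} \<Rightarrow> 'd::{banach, second_countable_topology}"
  assumes bilinear: "bounded_bilinear prod" and G_tendsto: "L1_tendsto M G g"
    and measurable_A: "\<And>n. A n \<in> borel_measurable M" "a \<in> borel_measurable M"
    and bound: "\<And>n x. norm (A n x) \<le> C" "\<And>x. norm (a x) \<le> C"
    and lim: "AE x in M. (\<lambda>n. A n x) \<longlonglongrightarrow> a x"
  shows "L1_tendsto M (\<lambda>n x. prod (A n x) (G n x)) (\<lambda>x. prod (a x) (g x))"
proof -
  obtain K where K_bound: "0 < K" "\<And>a b. norm (prod a b) \<le> norm a * norm b * K"
    using bounded_bilinear.pos_bounded[OF bilinear] by blast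
  have [measurable]: "g \<in> borel_measurable M" "A n \<in> borel_measurable M"
    "a \<in> borel_measurable M" for n
    using measurable_A L1_tendsto_integrable(2)[OF G_tendsto] by auto
  have bound_diff: "norm (A n x - a x) \<le> 2 * C" for n x
    using bound(1)[of n x] bound(2)[of x] norm_triangle_ineq4[of "A n x" "a x"] by linarith
  have A_tendsto: "L1_tendsto M (\<lambda>n x. norm (A n x - a x) * norm (g x)) (\<lambda>x. 0)"
  proof (rule L1_tendsto_dominated[where w = "\<lambda>x. 2 * C * norm (g x)"])
    show "AE x in M. (\<lambda>n. norm (A n x - a x) * norm (g x)) \<longlonglongrightarrow> 0"
      using lim by eventually_elim (auto intro!: tendsto_mult_left_zero tendsto_norm_zero LIM_zero)
    show "AE x in M. norm (norm (A n x - a x) * norm (g x)) \<le> 2 * C * norm (g x)" for n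
      using bound_diff by (intro AE_I2) (simp add: mult_right_mono)
  qed (use L1_tendsto_integrable(2)[OF G_tendsto] in auto)
  note A_integrable = L1_tendsto_integrable(1)[OF A_tendsto]
  show ?thesis
  proof (rule L1_tendstoI_bound)
    show "integrable M (\<lambda>x. prod (A n x) (G n x))" "integrable M (\<lambda>x. prod (a x) (g x))" for n
      by (rule integrable_bounded_bilinear[OF bilinear measurable_A(1) bound(1)
            L1_tendsto_integrable(1)[OF G_tendsto]]
          integrable_bounded_bilinear[OF bilinear measurable_A(2) bound(2)
            L1_tendsto_integrable(2)[OF G_tendsto]])+
    show "integrable M (\<lambda>x. (C * norm (G n x - g x) + norm (A n x - a x) * norm (g x)) * K)" for n
      using L1_tendsto_integrable[OF G_tendsto] A_integrable by simp
    have "(\<lambda>n. (C * (\<integral>x. norm (G n x - g x) \<partial>M) + (\<integral>x. norm (A n x - a x) * norm (g x) \<partial>M)) * K)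
        \<longlonglongrightarrow> 0"
      using G_tendsto L1_tendsto_integral[OF A_tendsto]
      by (intro tendsto_mult_left_zero tendsto_add_zero tendsto_mult_right_zero)
        (auto simp: L1_tendsto_def)
    then show "(\<lambda>n. \<integral>x. (C * norm (G n x - g x) + norm (A n x - a x) * norm (g x)) * K \<partial>M) \<longlonglongrightarrow> 0"
      using L1_tendsto_integrable[OF G_tendsto] A_integrable by simp
    show "norm (prod (A n x) (G n x) - prod (a x) (g x)) \<le>
        (C * norm (G n x - g x) + norm (A n x - a x) * norm (g x)) * K" for n x
      by (rule norm_bilinear_diff_le[OF bilinear K_bound bound(1)])
  qed
qed

lemma L1_tendsto_lipschitz_compose:
  fixes S :: "'b::{banach, second_countable_topology} \<Rightarrow> 'c::{banach, second_countable_topology}"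
  assumes finite_M: "finite_measure M" and lipschitz_S: "C-lipschitz_on UNIV S"
    and F_tendsto: "L1_tendsto M F f"
  shows "L1_tendsto M (\<lambda>n x. S (F n x)) (\<lambda>x. S (f x))"
proof (rule L1_tendstoI_bound)
  interpret finite_measure M by fact
  have S_diff: "norm (S a - S b) \<le> C * norm (a - b)" for a b
    using lipschitz_onD[OF lipschitz_S, of a b] by (simp add: dist_norm)
  have S_measurable: "S \<in> borel_measurable borel"
    using lipschitz_on_continuous_on[OF lipschitz_S] by (rule borel_measurable_continuous_onI)
  have "integrable M (\<lambda>x. S (h x))" if "integrable M h" for h
  proof (rule Bochner_Integration.integrable_bound[of M "\<lambda>x. C * norm (h x) + norm (S 0)"])
    show "AE x in M. norm (S (h x)) \<le> norm (C * norm (h x) + norm (S 0))"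
    proof (rule AE_I2)
      fix x
      have "norm (S (h x)) \<le> norm (S (h x) - S 0) + norm (S 0)"
        by (metis diff_add_cancel norm_triangle_ineq)
      then show "norm (S (h x)) \<le> norm (C * norm (h x) + norm (S 0))"
        using S_diff[of "h x" 0] by simp
    qed
  qed (use that measurable_compose[OF borel_measurable_integrable[OF that] S_measurable] in auto)
  then show "integrable M (\<lambda>x. S (F n x))" "integrable M (\<lambda>x. S (f x))" for n
    using L1_tendsto_integrable[OF F_tendsto] by blast+
  show "norm (S (F n x) - S (f x)) \<le> C * norm (F n x - f x)" for n x
    by (rule S_diff)
  show "(\<lambda>n. \<integral>x. C * norm (F n x - f x) \<partial>M) \<longlonglongrightarrow> 0"
    using F_tendsto by (simp add: L1_tendsto_def tendsto_mult_right_zero)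
qed (use L1_tendsto_integrable[OF F_tendsto] in auto)

lemma L1_tendsto_AE_subseq:
  assumes "L1_tendsto M F f"
  obtains s where "strict_mono s" "AE x in M. (\<lambda>n. F (s n) x) \<longlonglongrightarrow> f x"
proof -
  obtain s where subseq: "strict_mono s" "AE x in M. (\<lambda>n. F (s n) x - f x) \<longlonglongrightarrow> 0"
    using tendsto_L1_AE_subseq[of M "\<lambda>n x. F n x - f x"] assms by (auto simp: L1_tendsto_def)
  with that show thesis by (simp add: LIM_zero_iff)
qed

subsection \<open>Restriction to balls\<close>

lemma
  fixes f :: "'a::euclidean_space \<Rightarrow> 'b::euclidean_space"
  assumes "S \<in> sets lebesgue" "\<And>x. x \<notin> S \<Longrightarrow> f x = 0"
  shows integrable_lebesgue_on_vanishing: "integrable (lebesgue_on S) f \<longleftrightarrow> integrable lebesgue f"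
    and integral_lebesgue_on_vanishing: "integral\<^sup>L (lebesgue_on S) f = integral\<^sup>L lebesgue f"
proof -
  have "(\<lambda>x. if x \<in> S then f x else 0) = f"
    using assms(2) by auto
  then show "integrable (lebesgue_on S) f \<longleftrightarrow> integrable lebesgue f"
    "integral\<^sup>L (lebesgue_on S) f = integral\<^sup>L lebesgue f"
    using Lebesgue_Measure.integrable_restrict_UNIV[OF assms(1), of f]
      Lebesgue_Measure.integral_restrict_UNIV[OF assms(1), of f] by auto
qed

lemma finite_measure_lebesgue_on_cball:
  "finite_measure (lebesgue_on (cball (a::'a::euclidean_space) r))"
  by (intro finite_measure_lebesgue_on lmeasurable_cball)

lemma continuous_imp_integrable_lebesgue_on_cball:
  fixes f :: "'a::euclidean_space \<Rightarrow> 'b::euclidean_space"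
  assumes "continuous_on UNIV f" shows "integrable (lebesgue_on (cball a r)) f"
proof -
  have "integrable lborel (\<lambda>x. indicat_real (cball a r) x *\<^sub>R f x)"
    by (intro borel_integrable_compact compact_cball continuous_on_subset[OF assms] subset_UNIV)
  then have "integrable lebesgue (\<lambda>x. indicat_real (cball a r) x *\<^sub>R f x)"
    by (subst integrable_completion) auto
  then show ?thesis
    by (subst integrable_restrict_space) auto
qed

lemma Lp_loc_measurable:
  assumes "f \<in> Lp_loc p" shows "f \<in> borel_measurable lebesgue"
  using assms by (simp add: Lp_loc_def)

lemma Lp_loc_1_integrable_indicator_norm:
  assumes "f \<in> Lp_loc 1" shows "integrable lebesgue (\<lambda>x. indicat_real (cball a r) x * norm (f x))"
  using assms by (auto simp: Lp_loc_def set_integrable_def)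

lemma Lp_loc_1_integrable_on_cball:
  fixes f :: "'a::euclidean_space \<Rightarrow> 'b::euclidean_space"
  assumes "f \<in> Lp_loc 1" shows "integrable (lebesgue_on (cball a r)) f"
proof -
  have "integrable (lebesgue_on (cball a r)) (\<lambda>x. norm (f x))"
    using Lp_loc_1_integrable_indicator_norm[OF assms] by (subst integrable_restrict_space) auto
  then show ?thesis
    using measurable_restrict_space1[OF Lp_loc_measurable[OF assms]]
    by (simp add: integrable_norm_iff)
qed

lemma Lp_loc_1_integrable_bounded_bilinear:
  fixes f :: "'a::euclidean_space \<Rightarrow> 'b::euclidean_space" and g :: "'a \<Rightarrow> 'c::euclidean_space"
    and prod :: "'c \<Rightarrow> 'b \<Rightarrow> 'd::euclidean_space"
  assumes bilinear: "bounded_bilinear prod" and f_loc: "f \<in> Lp_loc 1"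
    and bounded_g: "g \<in> borel_measurable lebesgue" "\<And>x. norm (g x) \<le> C"
      "\<And>x. x \<notin> cball a r \<Longrightarrow> g x = 0"
  shows "integrable lebesgue (\<lambda>x. prod (g x) (f x))"
proof -
  have "integrable (lebesgue_on (cball a r)) (\<lambda>x. prod (g x) (f x))"
    using bounded_g
    by (intro integrable_bounded_bilinear[OF bilinear _ _ Lp_loc_1_integrable_on_cball[OF f_loc]])
      (auto intro: measurable_restrict_space1)
  then show ?thesis
    using bounded_g(3) bounded_bilinear.zero_left[OF bilinear]
    by (subst (asm) integrable_lebesgue_on_vanishing) auto
qed

lemma Lp_loc_1_integrable_C1_supported_mult:
  fixes f \<psi> :: "'a::euclidean_space \<Rightarrow> real"
  assumes \<psi>_supported: "\<psi> \<in> C1_supported_in (cball a r)" and f_loc: "f \<in> Lp_loc 1"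
  shows "integrable lebesgue (\<lambda>x. \<psi> x * f x)"
proof -
  obtain L where L_bound: "\<And>x. \<bar>\<psi> x\<bar> \<le> L"
    by (rule C1_supported_in_compact_bounds[OF \<psi>_supported compact_cball]) (rule that)
  have "\<psi> \<in> borel_measurable lebesgue"
    using is_C1_continuous[OF C1_supported_in_is_C1[OF \<psi>_supported]]
    by (intro measurable_completion) (simp add: borel_measurable_continuous_onI)
  then show ?thesis
    using L_bound C1_supported_in_eq_0[OF \<psi>_supported]
    by (intro Lp_loc_1_integrable_bounded_bilinear[OF bounded_bilinear_mult f_loc, of _ L a r]) auto
qed

lemma Lp_loc_const: "(\<lambda>x::'a::euclidean_space. c::'b::euclidean_space) \<in> Lp_loc p"
proof -
  have "integrable lebesgue (indicat_real K)" if "compact K" for K :: "'a set"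
    using lmeasurable_compact[OF that]
    by (intro integrable_real_indicator) (auto simp: fmeasurable_def)
  then show ?thesis by (simp add: Lp_loc_def set_integrable_def)
qed

subsection \<open>Continuity of translation in \<open>L\<^sup>1\<close>\<close>

lemma
  fixes F :: "'a::euclidean_space \<Rightarrow> 'b::{banach, second_countable_topology}"
  assumes abs_c: "\<bar>c\<bar> = 1" and [measurable]: "F \<in> borel_measurable borel"
  shows integrable_lborel_affine_iff: "integrable lborel (\<lambda>x. F (t + c *\<^sub>R x)) \<longleftrightarrow> integrable lborel F"
    and integral_lborel_affine: "(\<integral>x. F (t + c *\<^sub>R x) \<partial>lborel) = integral\<^sup>L lborel F"
proof -
  have "lborel = density (distr lborel borel (\<lambda>x::'a. t + c *\<^sub>R x)) (\<lambda>_. 1)"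
    using lborel_affine[of c t] abs_c by simp
  then have distr: "distr lborel borel (\<lambda>x::'a. t + c *\<^sub>R x) = lborel"
    by (simp add: density_1)
  have "integrable (distr lborel borel (\<lambda>x. t + c *\<^sub>R x)) F \<longleftrightarrow>
      integrable lborel (\<lambda>x. F (t + c *\<^sub>R x))"
    by (subst integrable_distr_eq) auto
  then show "integrable lborel (\<lambda>x. F (t + c *\<^sub>R x)) \<longleftrightarrow> integrable lborel F"
    by (simp add: distr)
  have "integral\<^sup>L (distr lborel borel (\<lambda>x. t + c *\<^sub>R x)) F = (\<integral>x. F (t + c *\<^sub>R x) \<partial>lborel)"
    by (subst integral_distr) auto
  then show "(\<integral>x. F (t + c *\<^sub>R x) \<partial>lborel) = integral\<^sup>L lborel F"
    by (simp add: distr)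
qed

lemma integrable_translate:
  fixes f :: "'a::euclidean_space \<Rightarrow> 'b::{banach, second_countable_topology}"
  assumes "integrable lborel f" shows "integrable lborel (\<lambda>x. f (y + x))"
  using assms integrable_lborel_affine_iff[of 1 f y] by simp

lemma integral_translate:
  fixes f :: "'a::euclidean_space \<Rightarrow> 'b::{banach, second_countable_topology}"
  assumes "integrable lborel f" shows "(\<integral>x. f (y + x) \<partial>lborel) = integral\<^sup>L lborel f"
  using assms integral_lborel_affine[of 1 f y] by simp

definition translation_modulus ::
    "('a::euclidean_space \<Rightarrow> 'b::{banach, second_countable_topology}) \<Rightarrow> 'a \<Rightarrow> real" where
  "translation_modulus f y = (\<integral>x. norm (f (y + x) - f x) \<partial>lborel)"

lemma translation_modulus_nonneg: "0 \<le> translation_modulus f y"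
  by (simp add: translation_modulus_def)

lemma translation_modulus_0: "translation_modulus f 0 = 0"
  by (simp add: translation_modulus_def)

lemma isCont_translation_modulus_iff:
  "isCont (translation_modulus f) 0 \<longleftrightarrow>
    (\<forall>e>0. \<exists>d>0. \<forall>y. norm y < d \<longrightarrow> translation_modulus f y < e)"
  unfolding continuous_at_eps_delta
  by (simp add: translation_modulus_0 translation_modulus_nonneg dist_real_def)

lemma translation_modulus_add_le:
  assumes integrable_f: "integrable lborel f" and integrable_g: "integrable lborel g"
  shows "translation_modulus (\<lambda>x. f x + g x) y \<le> translation_modulus f y + translation_modulus g y"
proof -
  note integrable = integrable_f integrable_g
    integrable_translate[OF integrable_f] integrable_translate[OF integrable_g]
  have "translation_modulus (\<lambda>x. f x + g x) y \<le>
      (\<integral>x. norm (f (y + x) - f x) + norm (g (y + x) - g x) \<partial>lborel)"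
    unfolding translation_modulus_def using integrable
    by (intro integral_mono) (auto simp: add_diff_add norm_triangle_ineq)
  then show ?thesis
    using integrable by (simp add: translation_modulus_def)
qed

lemma translation_modulus_le_norm:
  assumes integrable_f: "integrable lborel f"
  shows "translation_modulus f y \<le> 2 * (\<integral>x. norm (f x) \<partial>lborel)"
proof -
  have "translation_modulus f y \<le> (\<integral>x. norm (f (y + x)) + norm (f x) \<partial>lborel)"
    unfolding translation_modulus_def using integrable_f integrable_translate[OF integrable_f]
    by (intro integral_mono) (auto intro: norm_triangle_ineq4)
  then show ?thesis
    using integrable_f integrable_translate[OF integrable_f]
      integral_translate[of "\<lambda>x. norm (f x)" y] by simp
qed

lemma isCont_translation_modulus_limit:
  fixes f :: "'a::euclidean_space \<Rightarrow> 'b::{banach, second_countable_topology}"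
  assumes integrable_f: "integrable lborel f"
    and approx: "\<And>e. 0 < e \<Longrightarrow> \<exists>g. integrable lborel g \<and> isCont (translation_modulus g) 0 \<and>
      (\<integral>x. norm (f x - g x) \<partial>lborel) < e"
  shows "isCont (translation_modulus f) 0"
  unfolding isCont_translation_modulus_iff
proof (intro allI impI)
  fix e :: real assume e_pos: "0 < e"
  obtain g where g_approx: "integrable lborel g" "isCont (translation_modulus g) 0"
      "(\<integral>x. norm (f x - g x) \<partial>lborel) < e / 4"
    using approx[of "e / 4"] e_pos by auto
  obtain d where d_modulus: "0 < d" "\<And>y. norm y < d \<Longrightarrow> translation_modulus g y < e / 2"
    using g_approx(2) half_gt_zero[OF e_pos] unfolding isCont_translation_modulus_iff by blast
  note integrable_diff = Bochner_Integration.integrable_diff[OF integrable_f g_approx(1)]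
  have "translation_modulus f y < e" if "norm y < d" for y
    using translation_modulus_add_le[OF g_approx(1) integrable_diff, of y]
      translation_modulus_le_norm[OF integrable_diff, of y]
      d_modulus(2)[OF that] g_approx(3) by simp
  with d_modulus(1) show "\<exists>d>0. \<forall>y. norm y < d \<longrightarrow> translation_modulus f y < e"
    by blast
qed

lemma translation_modulus_indicator:
  fixes U :: "'a::euclidean_space set"
  assumes [measurable]: "U \<in> sets borel" and finite_U: "emeasure lborel U < \<infinity>"
  shows "translation_modulus (indicat_real U) y =
    2 * measure lborel U - 2 * (\<integral>x. indicat_real U (y + x) * indicat_real U x \<partial>lborel)"
proof -
  have integrable_U: "integrable lborel (indicat_real U)"
    using finite_U by simp
  have integrable_Int: "integrable lborel (\<lambda>x. indicat_real U (y + x) * indicat_real U x)"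
    by (rule Bochner_Integration.integrable_bound[OF integrable_U]) (auto simp: indicator_def)
  have "translation_modulus (indicat_real U) y =
      (\<integral>x. indicat_real U (y + x) + indicat_real U x -
        2 * (indicat_real U (y + x) * indicat_real U x) \<partial>lborel)"
    unfolding translation_modulus_def
    by (intro Bochner_Integration.integral_cong) (auto simp: indicator_def)
  then show ?thesis
    using integrable_U integrable_translate[OF integrable_U] integrable_Int
      integral_translate[OF integrable_U] by simp
qed

lemma isCont_translation_modulus_indicator_open:
  fixes U :: "'a::euclidean_space set"
  assumes U_open_finite: "open U" "emeasure lborel U < \<infinity>"
  shows "isCont (translation_modulus (indicat_real U)) 0"
  unfolding continuous_at_sequentially
proof (intro allI impI)
  fix Y :: "nat \<Rightarrow> 'a" assume Y_tendsto: "Y \<longlonglongrightarrow> 0"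
  have [measurable]: "U \<in> sets borel" using U_open_finite by simp
  have integrable_U: "integrable lborel (indicat_real U)" using U_open_finite by simp
  have "(\<lambda>n. \<integral>x. indicat_real U (Y n + x) * indicat_real U x \<partial>lborel) \<longlonglongrightarrow>
      (\<integral>x. indicat_real U x \<partial>lborel)"
  proof (rule integral_dominated_convergence[where w = "indicat_real U"])
    show "AE x in lborel. (\<lambda>n. indicat_real U (Y n + x) * indicat_real U x) \<longlonglongrightarrow> indicat_real U x"
    proof (rule AE_I2)
      fix x
      show "(\<lambda>n. indicat_real U (Y n + x) * indicat_real U x) \<longlonglongrightarrow> indicat_real U x"
      proof (cases "x \<in> U")
        case True
        have "(\<lambda>n. Y n + x) \<longlonglongrightarrow> x" using tendsto_add[OF Y_tendsto tendsto_const, of x] by simp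
        then have "eventually (\<lambda>n. Y n + x \<in> U) sequentially"
          using U_open_finite(1) True by (simp add: topological_tendstoD)
        then show ?thesis
          using True by (intro tendsto_eventually) (auto elim!: eventually_mono)
      qed simp
    qed
  qed (auto simp: integrable_U indicator_def)
  then show "(translation_modulus (indicat_real U) \<circ> Y) \<longlonglongrightarrow> translation_modulus (indicat_real U) 0"
    unfolding translation_modulus_0 o_def using U_open_finite(2)
    by (auto simp: translation_modulus_indicator intro!: tendsto_eq_intros)
qed

lemma isCont_translation_modulus_indicator:
  fixes A :: "'a::euclidean_space set" and c :: "'b::{banach, second_countable_topology}"
  assumes A_finite: "A \<in> sets borel" "emeasure lborel A < \<infinity>"
  shows "isCont (translation_modulus (\<lambda>x. indicat_real A x *\<^sub>R c)) 0"
proof (rule isCont_translation_modulus_limit)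
  fix e :: real assume e_pos: "0 < e"
  define \<delta> where "\<delta> = e / (norm c + 1)"
  have \<delta>_bounds: "0 < \<delta>" "\<delta> * norm c < e"
    using e_pos by (auto simp: \<delta>_def field_simps add_pos_nonneg intro!: divide_pos_pos)
  obtain U where U_approx: "open U" "A \<subseteq> U" "emeasure lborel (U - A) < \<delta>"
    using outer_regular_lborel[OF A_finite(1) \<delta>_bounds(1)] by blast
  have [measurable]: "A \<in> sets borel" "U \<in> sets borel" using A_finite U_approx by simp_all
  have "emeasure lborel U = emeasure lborel A + emeasure lborel (U - A)"
    using U_approx(2) by (subst plus_emeasure) (auto simp: Un_absorb1)
  then have finite_U: "emeasure lborel U < \<infinity>"
    using A_finite(2) U_approx(3) by (auto simp: less_top[symmetric])
  have "(\<integral>x. norm (indicat_real A x *\<^sub>R c - indicat_real U x *\<^sub>R c) \<partial>lborel) =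
      (\<integral>x. indicat_real (U - A) x * norm c \<partial>lborel)"
    using U_approx(2) by (intro Bochner_Integration.integral_cong) (auto simp: indicator_def)
  also have "\<dots> = measure lborel (U - A) * norm c" by simp
  also have "\<dots> \<le> \<delta> * norm c"
  proof (rule mult_right_mono)
    have "emeasure lborel (U - A) \<noteq> \<infinity>" using U_approx(3) by auto
    then show "measure lborel (U - A) \<le> \<delta>"
      using U_approx(3) \<delta>_bounds(1) by (simp add: emeasure_eq_ennreal_measure ennreal_less_iff)
  qed simp
  also have "\<dots> < e" by (rule \<delta>_bounds)
  finally have close: "(\<integral>x. norm (indicat_real A x *\<^sub>R c - indicat_real U x *\<^sub>R c) \<partial>lborel) < e" .
  have "translation_modulus (\<lambda>x. indicat_real U x *\<^sub>R c) =
      (\<lambda>y. translation_modulus (indicat_real U) y * norm c)"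
    by (simp add: translation_modulus_def fun_eq_iff flip: scaleR_diff_left)
  then have "isCont (translation_modulus (\<lambda>x. indicat_real U x *\<^sub>R c)) 0"
    using isCont_translation_modulus_indicator_open[OF U_approx(1) finite_U] by simp
  then show "\<exists>g. integrable lborel g \<and> isCont (translation_modulus g) 0 \<and>
      (\<integral>x. norm (indicat_real A x *\<^sub>R c - g x) \<partial>lborel) < e"
    using close finite_U by (intro exI[of _ "\<lambda>x. indicat_real U x *\<^sub>R c"]) simp
qed (use A_finite in simp)

theorem isCont_translation_modulus:
  fixes f :: "'a::euclidean_space \<Rightarrow> 'b::{banach, second_countable_topology}"
  assumes "integrable lborel f"
  shows "isCont (translation_modulus f) 0"
  using assms
proof (induction rule: integrable_induct)
  case (base A c)
  then show ?case by (intro isCont_translation_modulus_indicator) auto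
next
  case (add f g)
  have "(\<lambda>y. translation_modulus f y + translation_modulus g y) \<midarrow>0\<rightarrow> 0"
    using add.IH by (intro tendsto_add_zero) (simp_all add: isCont_def translation_modulus_0)
  then have "translation_modulus (\<lambda>x. f x + g x) \<midarrow>0\<rightarrow> 0"
    by (rule Lim_null_comparison[OF always_eventually, rotated])
      (simp add: translation_modulus_add_le[OF add.hyps(1,2)] translation_modulus_nonneg)
  then show ?case
    by (simp add: isCont_def translation_modulus_0)
next
  case (lim f s)
  have "L1_tendsto lborel s f"
    using lim by (intro L1_tendsto_dominated[where w = "\<lambda>x. 2 * norm (f x)"]) auto
  then have s_tendsto: "(\<lambda>i. \<integral>x. norm (f x - s i x) \<partial>lborel) \<longlonglongrightarrow> 0"
    by (simp add: L1_tendsto_def norm_minus_commute)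
  show ?case
  proof (rule isCont_translation_modulus_limit)
    fix e :: real assume "0 < e"
    then obtain i where "(\<integral>x. norm (f x - s i x) \<partial>lborel) < e"
      using order_tendstoD(2)[OF s_tendsto] by (auto simp: eventually_sequentially)
    then show "\<exists>g. integrable lborel g \<and> isCont (translation_modulus g) 0 \<and>
        (\<integral>x. norm (f x - g x) \<partial>lborel) < e"
      using lim.hyps(1) lim.IH by blast
  qed (use lim in simp)
qed

subsection \<open>Convolution with a \<open>C\<^sup>1\<close> kernel\<close>

lemma tendsto_integral_dominated_at_within:
  fixes r :: "'a::metric_space \<Rightarrow> 'b \<Rightarrow> 'c::{banach, second_countable_topology}"
  assumes measurable_r: "\<And>h. r h \<in> borel_measurable M" "l \<in> borel_measurable M"
    and integrable_w: "integrable M w"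
    and lim: "\<And>y. ((\<lambda>h. r h y) \<longlongrightarrow> l y) (at a within A)"
    and bound: "\<And>h y. h \<in> A - {a} \<Longrightarrow> norm (r h y) \<le> w y"
  shows "((\<lambda>h. \<integral>y. r h y \<partial>M) \<longlongrightarrow> (\<integral>y. l y \<partial>M)) (at a within A)"
  unfolding tendsto_at_iff_sequentially o_def
proof (intro allI impI)
  fix X assume X_tendsto: "\<forall>i. X i \<in> A - {a}" "X \<longlonglongrightarrow> a"
  show "(\<lambda>n. \<integral>y. r (X n) y \<partial>M) \<longlonglongrightarrow> (\<integral>y. l y \<partial>M)"
  proof (rule integral_dominated_convergence)
    show "AE y in M. (\<lambda>n. r (X n) y) \<longlonglongrightarrow> l y"
      using lim X_tendsto unfolding tendsto_at_iff_sequentially o_def by (intro AE_I2) blast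
    show "AE y in M. norm (r (X n) y) \<le> w y" for n
      using bound X_tendsto(1) by (intro AE_I2) blast
  qed (use measurable_r integrable_w in auto)
qed

lemma GDERIV_integral:
  fixes F :: "'a::euclidean_space \<Rightarrow> 'b \<Rightarrow> real"
  assumes integrable_F: "\<And>z. integrable M (F z)" and measurable_G: "G \<in> borel_measurable M"
    and integrable_w: "integrable M w"
    and deriv: "\<And>y. GDERIV (\<lambda>z. F z y) x :> G y" and bound: "\<And>y. norm (G y) \<le> w y"
    and lipschitz: "\<And>z y. norm (z - x) < 1 \<Longrightarrow> \<bar>F z y - F x y\<bar> \<le> w y * norm (z - x)"
  shows "GDERIV (\<lambda>z. \<integral>y. F z y \<partial>M) x :> (\<integral>y. G y \<partial>M)"
proof -
  define r where "r h y = (F (x + h) y - F x y - h \<bullet> G y) / norm h" for h y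
  have [measurable]: "F z \<in> borel_measurable M" "G \<in> borel_measurable M" for z
    using integrable_F measurable_G by auto
  have integrable_G: "integrable M G"
    by (rule Bochner_Integration.integrable_bound[OF integrable_w measurable_G])
      (auto intro: order_trans[OF bound abs_ge_self])
  have r_bound: "\<bar>r h y\<bar> \<le> 2 * w y" if "norm h < 1" "h \<noteq> 0" for h y
  proof -
    have "\<bar>h \<bullet> G y\<bar> \<le> w y * norm h"
      using Cauchy_Schwarz_ineq2[of h "G y"] mult_left_mono[OF bound[of y], of "norm h"]
      by (simp add: mult.commute)
    then have "\<bar>F (x + h) y - F x y - h \<bullet> G y\<bar> \<le> 2 * w y * norm h"
      using lipschitz[of "x + h" y] that abs_triangle_ineq4[of "F (x + h) y - F x y" "h \<bullet> G y"]
      by simp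
    then show ?thesis
      using that by (simp add: r_def field_simps)
  qed
  have at_eq: "at (0::'a) within ball 0 1 = at 0"
    by (rule at_within_open) auto
  have "((\<lambda>h. r h y) \<longlongrightarrow> 0) (at 0)" for y
  proof (rule tendsto_norm_zero_cancel)
    show "((\<lambda>h. norm (r h y)) \<longlongrightarrow> 0) (at 0)"
      using deriv[of y] by (simp add: gderiv_def has_derivative_at r_def)
  qed
  moreover have "r h \<in> borel_measurable M" for h
    unfolding r_def[abs_def] by measurable
  ultimately have "((\<lambda>h. \<integral>y. r h y \<partial>M) \<longlongrightarrow> 0) (at 0)"
    using tendsto_integral_dominated_at_within[of r M "\<lambda>y. 0" "\<lambda>y. 2 * w y" 0 "ball 0 1"]
      r_bound integrable_w
    by (simp add: at_eq)
  then have "((\<lambda>h. norm (\<integral>y. r h y \<partial>M)) \<longlongrightarrow> 0) (at 0)"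
    by (rule tendsto_norm_zero)
  moreover have "(\<integral>y. r h y \<partial>M) =
      ((\<integral>y. F (x + h) y \<partial>M) - (\<integral>y. F x y \<partial>M) - h \<bullet> (\<integral>y. G y \<partial>M)) / norm h" for h
    using integrable_F integrable_G unfolding r_def by simp
  ultimately show ?thesis
    by (simp add: gderiv_def has_derivative_at bounded_linear_inner_left)
qed

locale convolution_kernel =
  fixes k :: "'a::euclidean_space \<Rightarrow> real" and d :: real
  assumes supported: "k \<in> C1_supported_in (cball 0 d)"
begin

lemmas C1 = C1_supported_in_is_C1[OF supported]
  and vanishing = C1_supported_in_eq_0[OF supported]
  and grad_vanishing = C1_supported_in_grad_eq_0[OF supported closed_cball]

lemma measurable_kernel: "(\<lambda>y. k (x - y)) \<in> borel_measurable lebesgue"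
proof -
  have "continuous_on UNIV (\<lambda>y. k (x - y))"
    using is_C1_continuous[OF is_C1_reflect(1)[OF C1]] .
  then show ?thesis
    by (intro measurable_completion) (simp add: borel_measurable_continuous_onI)
qed

lemma measurable_grad_kernel: "(\<lambda>y. grad k (x - y)) \<in> borel_measurable lebesgue"
proof -
  have "continuous_on UNIV (\<lambda>y. grad k (x - y))"
    by (intro continuous_on_compose2[OF is_C1_continuous_grad[OF C1]] continuous_intros) auto
  then show ?thesis
    by (intro measurable_completion) (simp add: borel_measurable_continuous_onI)
qed

lemma kernel_bounds:
  obtains L where "\<And>x. \<bar>k x\<bar> \<le> L" "\<And>x. norm (grad k x) \<le> L"
    "\<And>x y. \<bar>k x - k y\<bar> \<le> L * norm (x - y)"
proof -
  obtain L where L_bound: "\<And>x. \<bar>k x\<bar> \<le> L" "\<And>x. norm (grad k x) \<le> L"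
    by (rule C1_supported_in_compact_bounds[OF supported compact_cball]) (rule that)
  show thesis
    by (rule that[OF L_bound is_C1_imp_lipschitz[OF C1 L_bound(2)]])
qed

lemma integrable_convolution:
  fixes f :: "'a \<Rightarrow> 'b::euclidean_space"
  assumes "f \<in> Lp_loc 1"
  shows "integrable lebesgue (\<lambda>y. k (x - y) *\<^sub>R f y)"
proof -
  obtain L where "\<And>x. \<bar>k x\<bar> \<le> L"
    by (rule kernel_bounds) (rule that)
  then show ?thesis
    using measurable_kernel vanishing
    by (intro Lp_loc_1_integrable_bounded_bilinear[OF bounded_bilinear_scaleR assms, of _ L x d])
      (auto simp: dist_norm)
qed

lemma abs_kernel_diff_le:
  assumes "\<And>x y. \<bar>k x - k y\<bar> \<le> L * norm (x - y)" "norm (z - x) < 1"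
  shows "\<bar>k (z - y) - k (x - y)\<bar> \<le> L * indicat_real (cball x (d + 1)) y * norm (z - x)"
proof (cases "y \<in> cball x (d + 1)")
  case True
  then show ?thesis using assms(1)[of "z - y" "x - y"] by simp
next
  case False
  then have "k (z - y) = 0" "k (x - y) = 0"
    using assms(2) norm_triangle_sub[of "x - y" "z - y"]
    by (auto intro!: vanishing simp: dist_norm norm_minus_commute)
  with False show ?thesis by simp
qed

lemma norm_grad_kernel_le:
  assumes "\<And>x. norm (grad k x) \<le> L"
  shows "norm (grad k (x - y)) \<le> L * indicat_real (cball x (d + 1)) y"
proof (cases "y \<in> cball x (d + 1)")
  case False
  then have "grad k (x - y) = 0"
    by (intro grad_vanishing) (auto simp: dist_norm norm_minus_commute)
  with False show ?thesis by simp
qed (use assms in simp)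

lemma GDERIV_convolution:
  assumes u_loc: "u \<in> Lp_loc 1"
  shows "GDERIV (\<lambda>x. \<integral>y. k (x - y) *\<^sub>R u y \<partial>lebesgue) x :> (\<integral>y. u y *\<^sub>R grad k (x - y) \<partial>lebesgue)"
proof -
  obtain L where L_bound: "\<And>x. norm (grad k x) \<le> L" "\<And>x y. \<bar>k x - k y\<bar> \<le> L * norm (x - y)"
    by (rule kernel_bounds) (rule that)
  define w where "w y = L * (indicat_real (cball x (d + 1)) y * \<bar>u y\<bar>)" for y
  show ?thesis
  proof (rule GDERIV_integral[where w = w])
    show "integrable lebesgue (\<lambda>y. k (z - y) *\<^sub>R u y)" for z
      by (rule integrable_convolution[OF u_loc])
    show "(\<lambda>y. u y *\<^sub>R grad k (x - y)) \<in> borel_measurable lebesgue"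
      using Lp_loc_measurable[OF u_loc] measurable_grad_kernel by (rule borel_measurable_scaleR)
    show "integrable lebesgue w"
      unfolding w_def using Lp_loc_1_integrable_indicator_norm[OF u_loc, of x "d + 1"] by simp
    show "GDERIV (\<lambda>z. k (z - y) *\<^sub>R u y) x :> u y *\<^sub>R grad k (x - y)" for y
    proof -
      have "((\<lambda>z. z - y) has_derivative (\<lambda>h. h)) (at x)"
        by (auto intro!: derivative_eq_intros)
      from has_derivative_compose[OF this is_C1_GDERIV[OF C1, unfolded gderiv_def]]
      show ?thesis
        unfolding gderiv_def by (auto intro!: derivative_eq_intros simp: mult.commute)
    qed
    show "norm (u y *\<^sub>R grad k (x - y)) \<le> w y" for y
      using mult_left_mono[OF norm_grad_kernel_le[OF L_bound(1), of x y], of "\<bar>u y\<bar>"]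
      by (simp add: w_def mult_ac)
    show "\<bar>k (z - y) *\<^sub>R u y - k (x - y) *\<^sub>R u y\<bar> \<le> w y * norm (z - x)" if "norm (z - x) < 1" for z y
    proof -
      have "\<bar>k (z - y) *\<^sub>R u y - k (x - y) *\<^sub>R u y\<bar> = \<bar>k (z - y) - k (x - y)\<bar> * \<bar>u y\<bar>"
        by (simp add: left_diff_distrib flip: abs_mult)
      then show ?thesis
        using mult_right_mono[OF abs_kernel_diff_le[OF L_bound(2) that, of y], of "\<bar>u y\<bar>"]
        by (simp add: w_def mult_ac)
    qed
  qed
qed

lemma continuous_convolution:
  fixes f :: "'a \<Rightarrow> 'b::euclidean_space"
  assumes f_loc: "f \<in> Lp_loc 1"
  shows "continuous_on UNIV (\<lambda>x. \<integral>y. k (x - y) *\<^sub>R f y \<partial>lebesgue)"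
proof -
  obtain L where L_bound: "\<And>x y. \<bar>k x - k y\<bar> \<le> L * norm (x - y)"
    by (rule kernel_bounds) (rule that)
  let ?U = "\<lambda>x. \<integral>y. k (x - y) *\<^sub>R f y \<partial>lebesgue"
  have "(?U \<longlongrightarrow> ?U x) (at x)" for x
  proof (rule LIM_zero_cancel, rule Lim_null_comparison)
    define c where "c = L * (\<integral>y. indicat_real (cball x (d + 1)) y * norm (f y) \<partial>lebesgue)"
    show "((\<lambda>z. c * norm (z - x)) \<longlongrightarrow> 0) (at x)"
      by (auto intro!: tendsto_eq_intros)
    have "norm (?U z - ?U x) \<le> c * norm (z - x)" if "norm (z - x) < 1" for z
    proof -
      have "norm (?U z - ?U x) = norm (\<integral>y. (k (z - y) - k (x - y)) *\<^sub>R f y \<partial>lebesgue)"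
        using integrable_convolution[OF f_loc] by (simp add: scaleR_diff_left)
      also have "\<dots> \<le>
          (\<integral>y. L * (indicat_real (cball x (d + 1)) y * norm (f y)) * norm (z - x) \<partial>lebesgue)"
      proof (rule order_trans[OF integral_norm_bound integral_mono])
        show "integrable lebesgue (\<lambda>y. norm ((k (z - y) - k (x - y)) *\<^sub>R f y))"
          using integrable_convolution[OF f_loc]
          by (intro integrable_norm) (simp add: scaleR_diff_left)
        show "integrable lebesgue
            (\<lambda>y. L * (indicat_real (cball x (d + 1)) y * norm (f y)) * norm (z - x))"
          using Lp_loc_1_integrable_indicator_norm[OF f_loc, of x "d + 1"] by simp
        show "norm ((k (z - y) - k (x - y)) *\<^sub>R f y) \<le>
            L * (indicat_real (cball x (d + 1)) y * norm (f y)) * norm (z - x)" for y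
          using mult_right_mono[OF abs_kernel_diff_le[OF L_bound that, of y], of "norm (f y)"]
          by (simp add: mult_ac)
      qed
      finally show ?thesis by (simp add: c_def)
    qed
    moreover have "\<forall>\<^sub>F z in at x. norm (z - x) < 1"
      unfolding eventually_at by (auto simp: dist_norm intro!: exI[of _ 1])
    ultimately show "\<forall>\<^sub>F z in at x. norm (?U z - ?U x) \<le> c * norm (z - x)"
      by (auto elim: eventually_mono)
  qed
  then show ?thesis by (simp add: continuous_on_def)
qed

lemma is_weak_grad_convolution:
  assumes u_loc: "u \<in> Lp_loc 1" and g_weak_grad: "is_weak_grad u g"
  shows "is_C1 (\<lambda>x. \<integral>y. k (x - y) *\<^sub>R u y \<partial>lebesgue)"
    "grad (\<lambda>x. \<integral>y. k (x - y) *\<^sub>R u y \<partial>lebesgue) = (\<lambda>x. \<integral>y. k (x - y) *\<^sub>R g y \<partial>lebesgue)"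
proof -
  have g_loc: "g \<in> Lp_loc 1"
    using g_weak_grad by (simp add: is_weak_grad_def)
  have "(\<integral>y. u y *\<^sub>R grad k (x - y) \<partial>lebesgue) = (\<integral>y. k (x - y) *\<^sub>R g y \<partial>lebesgue)" for x
  proof -
    have "(\<lambda>y. k (x - y)) \<in> C1_supported_in (cball x d)"
      using is_C1_reflect(1)[OF C1] vanishing by (simp add: C1_supported_in_def dist_norm)
    then have "(\<lambda>y. k (x - y)) \<in> C1_0"
      by (rule C1_supported_in_C1_0) simp
    with g_weak_grad show ?thesis
      by (auto simp: is_weak_grad_def is_C1_reflect(2)[OF C1] dest!: bspec)
  qed
  then have deriv: "GDERIV (\<lambda>x. \<integral>y. k (x - y) *\<^sub>R u y \<partial>lebesgue) x :>
      (\<integral>y. k (x - y) *\<^sub>R g y \<partial>lebesgue)" for x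
    using GDERIV_convolution[OF u_loc, of x] by simp
  show "is_C1 (\<lambda>x. \<integral>y. k (x - y) *\<^sub>R u y \<partial>lebesgue)"
    "grad (\<lambda>x. \<integral>y. k (x - y) *\<^sub>R u y \<partial>lebesgue) = (\<lambda>x. \<integral>y. k (x - y) *\<^sub>R g y \<partial>lebesgue)"
    by (rule is_C1I[OF deriv continuous_convolution[OF g_loc]])+
qed

end

subsection \<open>Mollification\<close>

lemma norm_convolution_diff_le_nn_integral:
  fixes f :: "'a::euclidean_space \<Rightarrow> 'b::{banach, second_countable_topology}" and k :: "'a \<Rightarrow> real"
  assumes measurable_f: "f \<in> borel_measurable borel"
    and k_density: "integrable lborel k" "\<And>x. 0 \<le> k x" "integral\<^sup>L lborel k = 1"
  shows "ennreal (norm ((\<integral>y. k (x - y) *\<^sub>R f y \<partial>lborel) - f x)) \<le>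
    (\<integral>\<^sup>+y. ennreal (k y) * ennreal (norm (f (x - y) - f x)) \<partial>lborel)" (is "_ \<le> ?G")
proof (cases "?G = \<infinity>")
  case False
  have [measurable]: "f \<in> borel_measurable borel" "k \<in> borel_measurable borel"
    using measurable_f k_density by auto
  have G_eq: "?G = (\<integral>\<^sup>+y. ennreal (norm (k y *\<^sub>R (f (x - y) - f x))) \<partial>lborel)"
    by (intro nn_integral_cong) (simp add: k_density(2) ennreal_mult)
  have integrable_diff: "integrable lborel (\<lambda>y. k y *\<^sub>R (f (x - y) - f x))"
    using False unfolding G_eq by (intro integrableI_bounded) (auto simp: less_top)
  have "(\<integral>y. k (x - y) *\<^sub>R f y \<partial>lborel) = (\<integral>y. k y *\<^sub>R f (x - y) \<partial>lborel)"
    using integral_lborel_affine[of "-1" "\<lambda>y. k y *\<^sub>R f (x - y)" x] by simp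
  also have "\<dots> = (\<integral>y. k y *\<^sub>R (f (x - y) - f x) + k y *\<^sub>R f x \<partial>lborel)"
    by (simp add: algebra_simps)
  also have "\<dots> = (\<integral>y. k y *\<^sub>R (f (x - y) - f x) \<partial>lborel) + f x"
    using integrable_diff k_density(1,3) by simp
  finally have "(\<integral>y. k (x - y) *\<^sub>R f y \<partial>lborel) - f x = (\<integral>y. k y *\<^sub>R (f (x - y) - f x) \<partial>lborel)"
    by simp
  then show ?thesis
    using integral_norm_bound_ennreal[OF integrable_diff] G_eq by simp
qed simp

lemma nn_integral_convolution_diff_le:
  fixes f :: "'a::euclidean_space \<Rightarrow> 'b::{banach, second_countable_topology}" and k :: "'a \<Rightarrow> real"
  assumes integrable_f: "integrable lborel f"
    and k_density: "integrable lborel k" "\<And>x. 0 \<le> k x" "integral\<^sup>L lborel k = 1"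
    and vanishing: "\<And>x. x \<notin> cball 0 d \<Longrightarrow> k x = 0"
    and modulus: "\<And>y. norm y \<le> d \<Longrightarrow> translation_modulus f y \<le> e"
  shows "(\<integral>\<^sup>+x. norm ((\<integral>y. k (x - y) *\<^sub>R f y \<partial>lborel) - f x) \<partial>lborel) \<le> ennreal e"
proof -
  have [measurable]: "f \<in> borel_measurable borel" "k \<in> borel_measurable borel"
    using integrable_f k_density by auto
  have "(\<integral>\<^sup>+x. norm ((\<integral>y. k (x - y) *\<^sub>R f y \<partial>lborel) - f x) \<partial>lborel) \<le>
      (\<integral>\<^sup>+x. \<integral>\<^sup>+y. ennreal (k y) * ennreal (norm (f (x - y) - f x)) \<partial>lborel \<partial>lborel)"
    using k_density by (intro nn_integral_mono norm_convolution_diff_le_nn_integral) auto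
  also have "\<dots> = (\<integral>\<^sup>+y. \<integral>\<^sup>+x. ennreal (k y) * ennreal (norm (f (x - y) - f x)) \<partial>lborel \<partial>lborel)"
    by (rule lborel_pair.Fubini') measurable
  also have "\<dots> \<le> (\<integral>\<^sup>+y. ennreal (k y) * ennreal e \<partial>lborel)"
  proof (rule nn_integral_mono)
    fix y :: 'a
    show "(\<integral>\<^sup>+x. ennreal (k y) * ennreal (norm (f (x - y) - f x)) \<partial>lborel) \<le>
        ennreal (k y) * ennreal e"
    proof (cases "norm y \<le> d")
      case True
      have "(\<integral>\<^sup>+x. ennreal (norm (f (x - y) - f x)) \<partial>lborel) = ennreal (translation_modulus f (- y))"
        using integrable_f integrable_translate[OF integrable_f, of "- y"]
        by (subst nn_integral_eq_integral) (auto simp: translation_modulus_def)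
      also have "\<dots> \<le> ennreal e"
        using modulus[of "- y"] True by (simp add: ennreal_leI)
      finally show ?thesis
        by (simp add: nn_integral_cmult mult_left_mono)
    qed (use vanishing in simp)
  qed
  also have "\<dots> = ennreal e"
    using k_density by (simp add: nn_integral_multc nn_integral_eq_integral)
  finally show ?thesis .
qed

lemma integrable_cutoff:
  assumes "0 < R" "2 \<le> m"
  shows "integrable lborel (cutoff m R :: 'a::euclidean_space \<Rightarrow> real)"
proof -
  have cont: "continuous_on UNIV (cutoff m R :: 'a \<Rightarrow> real)"
    by (rule is_C1_continuous[OF is_C1_cutoff(1)[OF assms(2)]])
  from continuous_imp_integrable_lebesgue_on_cball[OF this, of 0 R]
  have "integrable lebesgue (cutoff m R :: 'a \<Rightarrow> real)"
    using C1_supported_in_eq_0[OF cutoff_supported[OF assms]]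
    by (subst (asm) integrable_lebesgue_on_vanishing) auto
  then show ?thesis
    using borel_measurable_continuous_onI[OF cont] by (subst (asm) integrable_completion) auto
qed

lemma integral_cutoff_pos:
  assumes "0 < R" "2 \<le> m"
  shows "0 < integral\<^sup>L lborel (cutoff m R :: 'a::euclidean_space \<Rightarrow> real)"
proof (rule ccontr)
  assume "\<not> ?thesis"
  then have "integral\<^sup>L lborel (cutoff m R :: 'a \<Rightarrow> real) = 0"
    by (simp add: antisym cutoff_nonneg Bochner_Integration.integral_nonneg)
  then have "AE x in lborel. cutoff m R (x::'a) = 0"
    using integrable_cutoff[OF assms] cutoff_nonneg
    by (subst (asm) integral_nonneg_eq_0_iff_AE) auto
  then have "AE x in lborel. x \<notin> ball (0::'a) R"
    by (rule eventually_mono) (metis cutoff_pos[OF assms(1)] less_irrefl mem_ball_0)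
  then have "ball (0::'a) R \<in> null_sets lborel"
    by (subst AE_iff_null_sets) auto
  then show False
    using content_ball_pos[OF assms(1), of "0::'a"] by (simp add: measure_eq_0_null_sets)
qed

definition mollifier :: "real \<Rightarrow> 'a::euclidean_space \<Rightarrow> real" where
  "mollifier d x = cutoff 2 d x / (\<integral>y. cutoff 2 d y \<partial>(lborel::'a measure))"

lemma
  assumes "0 < d"
  shows mollifier_kernel: "convolution_kernel (mollifier d :: 'a::euclidean_space \<Rightarrow> real) d"
    and integrable_mollifier: "integrable lborel (mollifier d :: 'a \<Rightarrow> real)"
    and integral_mollifier: "integral\<^sup>L lborel (mollifier d :: 'a \<Rightarrow> real) = 1"
    and mollifier_nonneg: "0 \<le> mollifier d (x::'a)"
proof -
  note pos = integral_cutoff_pos[OF assms, of 2, where 'a = 'a]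
  show "convolution_kernel (mollifier d :: 'a \<Rightarrow> real) d"
  proof
    have "is_C1 (mollifier d :: 'a \<Rightarrow> real)"
      unfolding mollifier_def[abs_def] divide_inverse
      by (intro is_C1_mult is_C1_cutoff is_C1_const) simp
    then show "(mollifier d :: 'a \<Rightarrow> real) \<in> C1_supported_in (cball 0 d)"
      using C1_supported_in_eq_0[OF cutoff_supported[OF assms, of 2, where 'a = 'a]]
      by (simp add: C1_supported_in_def mollifier_def)
  qed
  show "integrable lborel (mollifier d :: 'a \<Rightarrow> real)"
    "integral\<^sup>L lborel (mollifier d :: 'a \<Rightarrow> real) = 1"
    using integrable_cutoff[OF assms, of 2, where 'a = 'a] pos
    by (auto simp: mollifier_def[abs_def])
  show "0 \<le> mollifier d x"
    using pos by (simp add: mollifier_def cutoff_nonneg)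
qed

definition mollify ::
    "real \<Rightarrow> ('a::euclidean_space \<Rightarrow> 'b::euclidean_space) \<Rightarrow> 'a \<Rightarrow> 'b" where
  "mollify d f x = (\<integral>y. mollifier d (x - y) *\<^sub>R f y \<partial>lebesgue)"

lemma continuous_mollify: "0 < d \<Longrightarrow> f \<in> Lp_loc 1 \<Longrightarrow> continuous_on UNIV (mollify d f)"
  unfolding mollify_def[abs_def]
  by (rule convolution_kernel.continuous_convolution[OF mollifier_kernel])

lemma is_weak_grad_mollify:
  assumes "0 < d" "u \<in> Lp_loc 1" "is_weak_grad u g"
  shows "is_C1 (mollify d u)" "grad (mollify d u) = mollify d g"
  unfolding mollify_def[abs_def]
  using convolution_kernel.is_weak_grad_convolution[OF mollifier_kernel] assms by blast+

lemma integrable_lebesgue_lborel_representative: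
  fixes f :: "'a::euclidean_space \<Rightarrow> 'b::euclidean_space"
  assumes integrable_f: "integrable lebesgue f"
  obtains f' where "integrable lborel f'" "AE x in lebesgue. f x = f' x"
proof -
  have "\<exists>g. g \<in> borel_measurable lborel \<and> (AE x in lborel. f x \<bullet> b = g x)" for b
    using completion_ex_borel_measurable_real[of "\<lambda>x. f x \<bullet> b" lborel] integrable_f by auto
  then obtain g where g_eq: "\<And>b. g b \<in> borel_measurable lborel"
      "\<And>b. AE x in lborel. f x \<bullet> b = g b x"
    by metis
  define f' where "f' x = (\<Sum>b\<in>Basis. g b x *\<^sub>R b)" for x
  have measurable_f': "f' \<in> borel_measurable lborel"
    unfolding f'_def using g_eq(1) by (intro borel_measurable_sum borel_measurable_scaleR) auto
  have "AE x in lborel. \<forall>b\<in>Basis. f x \<bullet> b = g b x"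
    using g_eq(2) by (simp add: AE_finite_all)
  then have "AE x in lborel. f x = f' x"
    unfolding f'_def
    by eventually_elim (metis (mono_tags, lifting) euclidean_representation sum.cong)
  then have f'_eq: "AE x in lebesgue. f x = f' x"
    by (rule AE_completion)
  then have "integrable lebesgue f'"
    using integrable_f measurable_completion[OF measurable_f']
    by (subst integrable_cong_AE[of _ _ f]) auto
  with that f'_eq show thesis
    using integrable_completion[OF measurable_f'] by blast
qed

lemma mollify_local_representative:
  fixes f :: "'a::euclidean_space \<Rightarrow> 'b::euclidean_space"
  assumes d_pos: "0 < d" and cball_subset: "cball x d \<subseteq> B"
    and measurable_F: "F \<in> borel_measurable borel" and measurable_f: "f \<in> borel_measurable lebesgue"
    and f_eq_F: "AE y in lebesgue. indicat_real B y *\<^sub>R f y = F y"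
  shows "mollify d f x = (\<integral>y. mollifier d (x - y) *\<^sub>R F y \<partial>lborel)"
proof -
  interpret convolution_kernel "mollifier d :: 'a \<Rightarrow> real" d by (rule mollifier_kernel[OF d_pos])
  have "mollify d f x = (\<integral>y. mollifier d (x - y) *\<^sub>R F y \<partial>lebesgue)"
    unfolding mollify_def
  proof (rule integral_cong_AE)
    show "AE y in lebesgue. mollifier d (x - y) *\<^sub>R f y = mollifier d (x - y) *\<^sub>R F y"
      using f_eq_F
    proof eventually_elim
      case (elim y)
      show ?case
      proof (cases "y \<in> B")
        case False
        then have "mollifier d (x - y) = (0::real)"
          using cball_subset by (intro vanishing) (auto simp: dist_norm norm_minus_commute)
        then show ?thesis by simp
      qed (use elim in simp)
    qed
    show "(\<lambda>y. mollifier d (x - y) *\<^sub>R f y) \<in> borel_measurable lebesgue"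
      using measurable_kernel measurable_f by (rule borel_measurable_scaleR)
    show "(\<lambda>y. mollifier d (x - y) *\<^sub>R F y) \<in> borel_measurable lebesgue"
      using measurable_F
      by (intro borel_measurable_scaleR[OF measurable_kernel] measurable_completion) simp
  qed
  also have "\<dots> = (\<integral>y. mollifier d (x - y) *\<^sub>R F y \<partial>lborel)"
    using measurable_F borel_measurable_continuous_onI[OF is_C1_continuous[OF C1]]
    by (intro integral_completion borel_measurable_scaleR) auto
  finally show ?thesis .
qed

lemma integral_norm_mollify_diff_le:
  fixes f :: "'a::euclidean_space \<Rightarrow> 'b::euclidean_space"
  assumes f_loc: "f \<in> Lp_loc 1" and integrable_F: "integrable lborel F"
    and f_eq_F: "AE x in lebesgue. indicat_real (cball a (r + 1)) x *\<^sub>R f x = F x"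
    and d_bounds: "0 < d" "d \<le> 1" and modulus_le: "\<And>y. norm y \<le> d \<Longrightarrow> translation_modulus F y \<le> e"
  shows "(\<integral>x. norm (mollify d f x - f x) \<partial>lebesgue_on (cball a r)) \<le> e"
proof (rule integral_real_bounded)
  show "0 \<le> e"
    using modulus_le[of 0] d_bounds(1) by (simp add: translation_modulus_0)
  have "(\<integral>\<^sup>+x. ennreal (norm (mollify d f x - f x)) \<partial>lebesgue_on (cball a r)) =
      (\<integral>\<^sup>+x. ennreal (norm (mollify d f x - f x)) * indicator (cball a r) x \<partial>lebesgue)"
    by (simp add: nn_integral_restrict_space)
  also have "\<dots> \<le> (\<integral>\<^sup>+x. ennreal (norm ((\<integral>y. mollifier d (x - y) *\<^sub>R F y \<partial>lborel) - F x)) \<partial>lebesgue)"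
  proof (rule nn_integral_mono_AE)
    show "AE x in lebesgue. ennreal (norm (mollify d f x - f x)) * indicator (cball a r) x \<le>
        ennreal (norm ((\<integral>y. mollifier d (x - y) *\<^sub>R F y \<partial>lborel) - F x))"
      using f_eq_F
    proof eventually_elim
      case (elim x)
      show ?case
      proof (cases "x \<in> cball a r")
        case True
        then have "cball x d \<subseteq> cball a (r + 1)"
          using d_bounds(2) by (auto simp: cball_subset_cball_iff dist_commute)
        then have "mollify d f x = (\<integral>y. mollifier d (x - y) *\<^sub>R F y \<partial>lborel)"
          using integrable_F
            mollify_local_representative[OF d_bounds(1) _ _ Lp_loc_measurable[OF f_loc] f_eq_F]
          by simp
        moreover have "F x = f x"
          using elim True by auto
        ultimately show ?thesis
          using True by simp
      qed simp
    qed
  qed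
  also have "\<dots> \<le> ennreal e"
    unfolding nn_integral_completion
    using convolution_kernel.vanishing[OF mollifier_kernel[OF d_bounds(1)]] d_bounds(1) modulus_le
    by (intro nn_integral_convolution_diff_le[OF integrable_F, of _ d])
      (auto intro: integrable_mollifier integral_mollifier mollifier_nonneg)
  finally show "(\<integral>\<^sup>+x. ennreal (norm (mollify d f x - f x)) \<partial>lebesgue_on (cball a r)) \<le> ennreal e" .
qed

theorem mollify_L1_tendsto:
  fixes f :: "'a::euclidean_space \<Rightarrow> 'b::euclidean_space"
  assumes f_loc: "f \<in> Lp_loc 1"
  shows "L1_tendsto (lebesgue_on (cball a r)) (\<lambda>n. mollify (1 / real (Suc n)) f) f"
proof -
  have "integrable lebesgue (\<lambda>x. indicat_real (cball a (r + 1)) x *\<^sub>R f x)"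
    using Lp_loc_1_integrable_on_cball[OF f_loc, of a "r + 1"]
    by (subst (asm) integrable_restrict_space) auto
  then obtain F where F_representative: "integrable lborel F"
      "AE x in lebesgue. indicat_real (cball a (r + 1)) x *\<^sub>R f x = F x"
    by (rule integrable_lebesgue_lborel_representative)
  have "(\<lambda>n. \<integral>x. norm (mollify (1 / real (Suc n)) f x - f x) \<partial>lebesgue_on (cball a r)) \<longlonglongrightarrow> 0"
  proof (rule LIMSEQ_I)
    fix e :: real assume e_pos: "0 < e"
    obtain d where d_modulus: "0 < d" "\<And>y. norm y < d \<Longrightarrow> translation_modulus F y < e / 2"
      using isCont_translation_modulus[OF F_representative(1)] half_gt_zero[OF e_pos]
      unfolding isCont_translation_modulus_iff by blast
    obtain N where N_large: "1 / real (Suc N) < d"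
      using nat_approx_posE[OF d_modulus(1)] by auto
    have "norm ((\<integral>x. norm (mollify (1 / real (Suc n)) f x - f x) \<partial>lebesgue_on (cball a r)) - 0) < e"
      if "N \<le> n" for n
    proof -
      have "1 / real (Suc n) \<le> 1 / real (Suc N)"
        using that by (intro divide_left_mono) auto
      then have "(\<integral>x. norm (mollify (1 / real (Suc n)) f x - f x) \<partial>lebesgue_on (cball a r)) \<le> e / 2"
        using d_modulus(2) N_large
        by (intro integral_norm_mollify_diff_le[OF f_loc F_representative]
            less_imp_le[OF d_modulus(2)]) auto
      then show ?thesis
        using e_pos by simp
    qed
    then show "\<exists>N. \<forall>n\<ge>N. norm ((\<integral>x. norm (mollify (1 / real (Suc n)) f x - f x)
        \<partial>lebesgue_on (cball a r)) - 0) < e"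
      by blast
  qed
  moreover have "integrable (lebesgue_on (cball a r)) (mollify (1 / real (Suc n)) f)" for n
    by (intro continuous_imp_integrable_lebesgue_on_cball continuous_mollify f_loc) simp
  ultimately show ?thesis
    using Lp_loc_1_integrable_on_cball[OF f_loc] by (simp add: L1_tendsto_def)
qed

subsection \<open>Strong gradients and nonlinear test functions\<close>

definition strong_grad_on :: "'a::euclidean_space set \<Rightarrow> ('a \<Rightarrow> real) \<Rightarrow> ('a \<Rightarrow> 'a) \<Rightarrow> bool" where
  "strong_grad_on B u g \<longleftrightarrow> (\<exists>U. (\<forall>n. is_C1 (U n)) \<and>
     L1_tendsto (lebesgue_on B) U u \<and> L1_tendsto (lebesgue_on B) (\<lambda>n. grad (U n)) g)"

lemma strong_grad_onI:
  assumes "\<And>n. is_C1 (U n)" "L1_tendsto (lebesgue_on B) U u"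
    "L1_tendsto (lebesgue_on B) (\<lambda>n. grad (U n)) g"
  shows "strong_grad_on B u g"
  using assms by (auto simp: strong_grad_on_def)

lemma strong_grad_on_measurable:
  assumes "strong_grad_on B u g"
  shows "u \<in> borel_measurable (lebesgue_on B)" "g \<in> borel_measurable (lebesgue_on B)"
  using assms by (auto simp: strong_grad_on_def L1_tendsto_def)

lemma weak_grad_imp_strong_grad_on:
  assumes "u \<in> Lp_loc 1" "is_weak_grad u g"
  shows "strong_grad_on (cball a r) u g"
proof (rule strong_grad_onI)
  have "g \<in> Lp_loc 1"
    using assms(2) by (simp add: is_weak_grad_def)
  moreover have "grad (mollify (1 / real (Suc n)) u) = mollify (1 / real (Suc n)) g" for n
    by (rule is_weak_grad_mollify(2)[OF _ assms]) simp
  ultimately show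
    "L1_tendsto (lebesgue_on (cball a r)) (\<lambda>n. grad (mollify (1 / real (Suc n)) u)) g"
    using mollify_L1_tendsto by simp
  show "is_C1 (mollify (1 / real (Suc n)) u)" for n
    by (rule is_weak_grad_mollify(1)[OF _ assms]) simp
qed (rule mollify_L1_tendsto[OF assms(1)])

lemma strong_grad_on_const: "strong_grad_on (cball a r) (\<lambda>x. c) (\<lambda>x. 0)"
  by (rule strong_grad_onI[of "\<lambda>n x. c"])
    (simp_all add: is_C1_const grad_const L1_tendsto_const
        continuous_imp_integrable_lebesgue_on_cball)

lemma strong_grad_on_diff:
  assumes "strong_grad_on B u gu" "strong_grad_on B v gv"
  shows "strong_grad_on B (\<lambda>x. u x - v x) (\<lambda>x. gu x - gv x)"
proof -
  obtain U where U_approx: "\<And>n. is_C1 (U n)" "L1_tendsto (lebesgue_on B) U u"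
      "L1_tendsto (lebesgue_on B) (\<lambda>n. grad (U n)) gu"
    using assms(1) by (auto simp: strong_grad_on_def)
  obtain V where V_approx: "\<And>n. is_C1 (V n)" "L1_tendsto (lebesgue_on B) V v"
      "L1_tendsto (lebesgue_on B) (\<lambda>n. grad (V n)) gv"
    using assms(2) by (auto simp: strong_grad_on_def)
  show ?thesis
    by (rule strong_grad_onI[of "\<lambda>n x. U n x - V n x"])
      (simp_all add: U_approx V_approx is_C1_diff L1_tendsto_diff)
qed

lemma strong_grad_on_AE_approximation:
  assumes "strong_grad_on B u g"
  obtains U where "\<And>n. is_C1 (U n)" "L1_tendsto (lebesgue_on B) U u"
    "L1_tendsto (lebesgue_on B) (\<lambda>n. grad (U n)) g" "AE x in lebesgue_on B. (\<lambda>n. U n x) \<longlonglongrightarrow> u x"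
proof -
  obtain U where U_approx: "\<And>n. is_C1 (U n)" "L1_tendsto (lebesgue_on B) U u"
      "L1_tendsto (lebesgue_on B) (\<lambda>n. grad (U n)) g"
    using assms by (auto simp: strong_grad_on_def)
  obtain s where subseq: "strict_mono s" "AE x in lebesgue_on B. (\<lambda>n. U (s n) x) \<longlonglongrightarrow> u x"
    by (rule L1_tendsto_AE_subseq[OF U_approx(2)])
  show thesis
    by (rule that[of "\<lambda>n. U (s n)"]) (use U_approx subseq L1_tendsto_subseq[OF _ subseq(1)] in auto)
qed

lemma AE_tendsto_compose:
  fixes T :: "'a::topological_space \<Rightarrow> 'b::topological_space"
  assumes "continuous_on UNIV T" "AE x in M. ((\<lambda>n. f n x) \<longlongrightarrow> l x) F"
  shows "AE x in M. ((\<lambda>n. T (f n x)) \<longlongrightarrow> T (l x)) F"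
  using assms(2)
  by eventually_elim (use assms(1) continuous_on_tendsto_compose in fastforce)

lemma strong_grad_on_compose:
  assumes u_strong_grad: "strong_grad_on (cball a r) u g"
    and S_deriv: "\<And>t. (S has_real_derivative S' t) (at t)" "continuous_on UNIV S'" "\<And>t. \<bar>S' t\<bar> \<le> C"
  shows "strong_grad_on (cball a r) (\<lambda>x. S (u x)) (\<lambda>x. S' (u x) *\<^sub>R g x)"
proof -
  let ?M = "lebesgue_on (cball a r)"
  obtain U where U_approx: "\<And>n. is_C1 (U n)" "L1_tendsto ?M U u"
      "L1_tendsto ?M (\<lambda>n. grad (U n)) g" "AE x in ?M. (\<lambda>n. U n x) \<longlonglongrightarrow> u x"
    by (rule strong_grad_on_AE_approximation[OF u_strong_grad]) (rule that)
  have S'_measurable: "S' \<in> borel_measurable borel"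
    by (rule borel_measurable_continuous_onI[OF S_deriv(2)])
  have U_measurable: "U n \<in> borel_measurable ?M" "u \<in> borel_measurable ?M" for n
    using L1_tendsto_integrable[OF U_approx(2)] by auto
  show ?thesis
  proof (rule strong_grad_onI[of "\<lambda>n x. S (U n x)"])
    show "is_C1 (\<lambda>x. S (U n x))" for n
      by (rule is_C1_compose(1)[OF U_approx(1) S_deriv(1,2)])
    have "C-lipschitz_on UNIV S"
    proof (rule lipschitz_onI)
      show "dist (S x) (S y) \<le> C * dist x y" for x y
        using field_differentiable_bound[of UNIV S S' C x y] S_deriv(1,3) by (simp add: dist_norm)
      show "0 \<le> C"
        using S_deriv(3)[of 0] by linarith
    qed
    then show "L1_tendsto ?M (\<lambda>n x. S (U n x)) (\<lambda>x. S (u x))"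
      by (rule L1_tendsto_lipschitz_compose[OF finite_measure_lebesgue_on_cball _ U_approx(2)])
    show "L1_tendsto ?M (\<lambda>n. grad (\<lambda>x. S (U n x))) (\<lambda>x. S' (u x) *\<^sub>R g x)"
      unfolding is_C1_compose(2)[OF U_approx(1) S_deriv(1,2)]
      using U_measurable[THEN measurable_compose[OF _ S'_measurable]] S_deriv(3)
        AE_tendsto_compose[OF S_deriv(2) U_approx(4)]
      by (intro L1_tendsto_bounded_bilinear[OF bounded_bilinear_scaleR U_approx(3), where C = C])
        auto
  qed
qed

lemma
  assumes C1_Z: "is_C1 Z" and \<phi>_supported: "\<phi> \<in> C1_supported_in B"
    and T_deriv: "\<And>t. (T has_real_derivative T' t) (at t)" "continuous_on UNIV T'"
  shows C1_supported_in_compose_mult: "(\<lambda>x. T (Z x) * \<phi> x) \<in> C1_supported_in B"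
    and grad_compose_mult: "grad (\<lambda>x. T (Z x) * \<phi> x) =
      (\<lambda>x. T (Z x) *\<^sub>R grad \<phi> x + (\<phi> x * T' (Z x)) *\<^sub>R grad Z x)"
  using is_C1_mult[OF is_C1_compose(1)[OF C1_Z T_deriv] C1_supported_in_is_C1[OF \<phi>_supported]]
    is_C1_compose(2)[OF C1_Z T_deriv] \<phi>_supported
  by (simp_all add: C1_supported_in_def)

lemma L1_tendsto_grad_compose_mult:
  fixes \<phi> z :: "'a::euclidean_space \<Rightarrow> real"
  assumes Z_C1: "\<And>n. is_C1 (Z n)" and Z_tendsto: "L1_tendsto (lebesgue_on (cball a r)) Z z"
    and grad_tendsto: "L1_tendsto (lebesgue_on (cball a r)) (\<lambda>n. grad (Z n)) g"
    and AE_tendsto: "AE x in lebesgue_on (cball a r). (\<lambda>n. Z n x) \<longlonglongrightarrow> z x"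
    and \<phi>_supported: "\<phi> \<in> C1_supported_in (cball a r)"
    and truncation: "\<And>t. (T has_real_derivative T' t) (at t)" "continuous_on UNIV T'"
      "\<And>t. \<bar>T t\<bar> \<le> A" "\<And>t. \<bar>T' t\<bar> \<le> A"
  shows "L1_tendsto (lebesgue_on (cball a r)) (\<lambda>n. grad (\<lambda>x. T (Z n x) * \<phi> x))
    (\<lambda>x. T (z x) *\<^sub>R grad \<phi> x + (\<phi> x * T' (z x)) *\<^sub>R g x)"
proof -
  let ?M = "lebesgue_on (cball a r)"
  note \<phi>_C1 = C1_supported_in_is_C1[OF \<phi>_supported]
  obtain L where L_bound: "0 < L" "\<And>x. \<bar>\<phi> x\<bar> \<le> L"
    by (rule C1_supported_in_compact_bounds[OF \<phi>_supported compact_cball]) (rule that)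
  have T_continuous: "continuous_on UNIV T"
    using truncation(1) by (rule DERIV_continuous_on)
  have integrable_\<phi>: "integrable ?M \<phi>" "integrable ?M (grad \<phi>)"
    using \<phi>_C1 by (auto intro: continuous_imp_integrable_lebesgue_on_cball is_C1_continuous
        is_C1_continuous_grad)
  have [measurable]: "T \<in> borel_measurable borel" "T' \<in> borel_measurable borel"
    "\<phi> \<in> borel_measurable ?M" "Z n \<in> borel_measurable ?M" "z \<in> borel_measurable ?M" for n
    using truncation(2) T_continuous integrable_\<phi> L1_tendsto_integrable[OF Z_tendsto]
    by (auto intro: borel_measurable_continuous_onI)
  note lim_T = AE_tendsto_compose[OF T_continuous AE_tendsto]
    and lim_T' = AE_tendsto_compose[OF truncation(2) AE_tendsto]
  have T'_bound: "\<bar>\<phi> x * T' t\<bar> \<le> L * A" for t x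
    using mult_mono[OF L_bound(2)[of x] truncation(4)[of t]] L_bound(1) by (simp add: abs_mult)
  have "L1_tendsto ?M (\<lambda>n x. T (Z n x) *\<^sub>R grad \<phi> x) (\<lambda>x. T (z x) *\<^sub>R grad \<phi> x)"
    using truncation(3) lim_T integrable_\<phi>(2)
    by (intro L1_tendsto_bounded_bilinear[OF bounded_bilinear_scaleR L1_tendsto_const,
          where C = A]) auto
  moreover have "L1_tendsto ?M (\<lambda>n x. (\<phi> x * T' (Z n x)) *\<^sub>R grad (Z n) x)
      (\<lambda>x. (\<phi> x * T' (z x)) *\<^sub>R g x)"
    using T'_bound eventually_mono[OF lim_T' tendsto_mult_left]
    by (intro L1_tendsto_bounded_bilinear[OF bounded_bilinear_scaleR grad_tendsto,
          where C = "L * A"]) auto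
  ultimately show ?thesis
    unfolding grad_compose_mult[OF Z_C1 \<phi>_supported truncation(1,2)] by (rule L1_tendsto_add)
qed

lemma strong_grad_on_truncation_approximation:
  fixes \<phi> z :: "'a::euclidean_space \<Rightarrow> real"
  assumes z_strong_grad: "strong_grad_on (cball a r) z g"
    and \<phi>_supported: "\<phi> \<in> C1_supported_in (cball a r)"
    and truncation: "\<And>t. (T has_real_derivative T' t) (at t)" "continuous_on UNIV T'"
      "\<And>t. \<bar>T t\<bar> \<le> A" "\<And>t. \<bar>T' t\<bar> \<le> A"
  obtains \<psi> B where "\<And>n. \<psi> n \<in> C1_supported_in (cball a r)"
    "\<And>n x. \<bar>\<psi> n x\<bar> \<le> B" "\<And>x. \<bar>T (z x) * \<phi> x\<bar> \<le> B"
    "AE x in lebesgue_on (cball a r). (\<lambda>n. \<psi> n x) \<longlonglongrightarrow> T (z x) * \<phi> x"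
    "L1_tendsto (lebesgue_on (cball a r)) (\<lambda>n. grad (\<psi> n))
      (\<lambda>x. T (z x) *\<^sub>R grad \<phi> x + (\<phi> x * T' (z x)) *\<^sub>R g x)"
proof -
  let ?M = "lebesgue_on (cball a r)"
  obtain Z where Z_approx: "\<And>n. is_C1 (Z n)" "L1_tendsto ?M Z z"
      "L1_tendsto ?M (\<lambda>n. grad (Z n)) g" "AE x in ?M. (\<lambda>n. Z n x) \<longlonglongrightarrow> z x"
    by (rule strong_grad_on_AE_approximation[OF z_strong_grad]) (rule that)
  obtain L where L_bound: "\<And>x. \<bar>\<phi> x\<bar> \<le> L"
    by (rule C1_supported_in_compact_bounds[OF \<phi>_supported compact_cball]) (rule that)
  have bound: "\<bar>T t * \<phi> x\<bar> \<le> A * L" for t x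
    using mult_mono[OF truncation(3)[of t] L_bound[of x]] truncation(3)[of t]
    by (auto simp: abs_mult)
  have "continuous_on UNIV T"
    using truncation(1) by (rule DERIV_continuous_on)
  then have "AE x in ?M. (\<lambda>n. T (Z n x)) \<longlonglongrightarrow> T (z x)"
    using Z_approx(4) by (rule AE_tendsto_compose)
  then have lim: "AE x in ?M. (\<lambda>n. T (Z n x) * \<phi> x) \<longlonglongrightarrow> T (z x) * \<phi> x"
    by eventually_elim (rule tendsto_mult_right)
  show thesis
    by (rule that[OF C1_supported_in_compose_mult[OF Z_approx(1) \<phi>_supported truncation(1,2)]
          bound bound lim L1_tendsto_grad_compose_mult[OF Z_approx \<phi>_supported truncation]])
qed

lemma strong_grad_on_truncated_test:
  fixes \<phi> z b :: "'a::euclidean_space \<Rightarrow> real" and w :: "'a \<Rightarrow> 'a"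
  assumes z_strong_grad: "strong_grad_on (cball a r) z g"
    and \<phi>_supported: "\<phi> \<in> C1_supported_in (cball a r)"
    and truncation: "\<And>t. (T has_real_derivative T' t) (at t)" "continuous_on UNIV T'"
      "\<And>t. \<bar>T t\<bar> \<le> A" "\<And>t. \<bar>T' t\<bar> \<le> A"
  defines "M \<equiv> lebesgue_on (cball a r)"
    and "G \<equiv> \<lambda>x. T (z x) *\<^sub>R grad \<phi> x + (\<phi> x * T' (z x)) *\<^sub>R g x"
  assumes w_bounded: "w \<in> borel_measurable M" "\<And>x. norm (w x) \<le> C"
    and integrable_b: "integrable M b"
    and weak_form: "\<forall>\<psi>\<in>C1_supported_in (cball a r).
      (\<integral>x. w x \<bullet> grad \<psi> x \<partial>M) + (\<integral>x. \<psi> x * b x \<partial>M) = 0"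
  shows "integrable M (\<lambda>x. w x \<bullet> G x)" "integrable M (\<lambda>x. T (z x) * \<phi> x * b x)"
    "(\<integral>x. w x \<bullet> G x \<partial>M) + (\<integral>x. T (z x) * \<phi> x * b x \<partial>M) = 0"
proof -
  obtain \<psi> B where \<psi>_supported: "\<And>n. \<psi> n \<in> C1_supported_in (cball a r)"
    and bound: "\<And>n x. \<bar>\<psi> n x\<bar> \<le> B" "\<And>x. \<bar>T (z x) * \<phi> x\<bar> \<le> B"
    and lim: "AE x in M. (\<lambda>n. \<psi> n x) \<longlonglongrightarrow> T (z x) * \<phi> x" "L1_tendsto M (\<lambda>n. grad (\<psi> n)) G"
    by (rule strong_grad_on_truncation_approximation[OF z_strong_grad \<phi>_supported truncation,
          folded M_def G_def]) (rule that)
  have measurable_C1: "f \<in> borel_measurable M" if "f \<in> C1_supported_in (cball a r)" for f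
    unfolding M_def using C1_supported_in_is_C1[OF that]
    by (intro borel_measurable_integrable continuous_imp_integrable_lebesgue_on_cball
        is_C1_continuous)
  have "z \<in> borel_measurable M"
    using strong_grad_on_measurable[OF z_strong_grad] by (simp add: M_def)
  then have "(\<lambda>x. T (z x)) \<in> borel_measurable M"
    using truncation(1)
    by (intro measurable_compose[of z _ borel T] borel_measurable_continuous_onI)
      (auto intro: DERIV_continuous_on)
  then have source_tendsto: "L1_tendsto M (\<lambda>n x. \<psi> n x * b x) (\<lambda>x. T (z x) * \<phi> x * b x)"
    using measurable_C1 \<psi>_supported \<phi>_supported bound lim(1) integrable_b
    by (intro L1_tendsto_bounded_bilinear[OF bounded_bilinear_mult L1_tendsto_const, where C = B])
      auto
  have flux_tendsto: "L1_tendsto M (\<lambda>n x. w x \<bullet> grad (\<psi> n) x) (\<lambda>x. w x \<bullet> G x)"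
    using w_bounded lim(2)
    by (intro L1_tendsto_bounded_bilinear[OF bounded_bilinear_inner, where C = C]) auto
  show "integrable M (\<lambda>x. w x \<bullet> G x)" "integrable M (\<lambda>x. T (z x) * \<phi> x * b x)"
    using L1_tendsto_integrable(2) flux_tendsto source_tendsto by blast+
  have "(\<lambda>n. 0) \<longlonglongrightarrow> (\<integral>x. w x \<bullet> G x \<partial>M) + (\<integral>x. T (z x) * \<phi> x * b x \<partial>M)"
    using tendsto_add[OF flux_tendsto[THEN L1_tendsto_integral]
        source_tendsto[THEN L1_tendsto_integral]] weak_form \<psi>_supported
    by simp
  then show "(\<integral>x. w x \<bullet> G x \<partial>M) + (\<integral>x. T (z x) * \<phi> x * b x \<partial>M) = 0"
    by (rule LIMSEQ_unique[OF _ tendsto_const])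
qed

subsection \<open>The mean curvature flux\<close>

definition flux :: "'a::euclidean_space \<Rightarrow> 'a" where
  "flux p = p /\<^sub>R sqrt (1 + (norm p)\<^sup>2)"

lemma norm_flux_le_1: "norm (flux p) \<le> 1"
proof -
  have "norm p \<le> sqrt (1 + (norm p)\<^sup>2)"
    by (rule real_le_rsqrt) simp
  then show ?thesis
    by (simp add: flux_def divide_inverse[symmetric] mult.commute[of "inverse _"] divide_le_eq_1
        add_pos_nonneg)
qed

lemma flux_measurable [measurable]: "flux \<in> borel_measurable borel"
  unfolding flux_def[abs_def] by measurable

text \<open>With \<open>W\<close> and \<open>V\<close> the area elements, the unit normals of the two graphs are
  \<open>(- flux \<xi>, 1/W)\<close> and \<open>(- flux \<eta>, 1/V)\<close>; \<open>c\<close> is their inner product and \<open>t\<close> the difference of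
  their last components.\<close>

lemma flux_weighted_monotone:
  fixes \<xi> \<eta> :: "'a::euclidean_space"
  assumes "0 < \<alpha>" "0 < \<beta>"
  shows "- ((\<alpha> - \<beta>)\<^sup>2 / (2 * (\<alpha> + \<beta>))) \<le> (flux \<xi> - flux \<eta>) \<bullet> (\<alpha> *\<^sub>R \<xi> - \<beta> *\<^sub>R \<eta>)"
proof -
  define W V where "W = sqrt (1 + (norm \<xi>)\<^sup>2)" and "V = sqrt (1 + (norm \<eta>)\<^sup>2)"
  define c where "c = (\<xi> \<bullet> \<eta> + 1) / (W * V)"
  define t where "t = 1 / W - 1 / V"
  have W_norm: "1 \<le> W" "\<xi> \<bullet> \<xi> = W\<^sup>2 - 1" and V_norm: "1 \<le> V" "\<eta> \<bullet> \<eta> = V\<^sup>2 - 1"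
    by (simp_all add: W_def V_def power2_norm_eq_inner)
  have flux_eq: "flux \<xi> = (1 / W) *\<^sub>R \<xi>" "flux \<eta> = (1 / V) *\<^sub>R \<eta>"
    by (simp_all add: flux_def W_def V_def divide_inverse)
  have inner_eq: "\<xi> \<bullet> \<eta> = c * W * V - 1"
    using W_norm V_norm by (simp add: c_def)
  have "0 \<le> (flux \<xi> - flux \<eta>) \<bullet> (flux \<xi> - flux \<eta>)" by simp
  also have "\<dots> = (\<xi> \<bullet> \<xi>) / W\<^sup>2 + (\<eta> \<bullet> \<eta>) / V\<^sup>2 - 2 * (\<xi> \<bullet> \<eta>) / (W * V)"
    using W_norm(1) V_norm(1) unfolding flux_eq
    by (simp add: inner_diff_left inner_diff_right inner_commute power2_eq_square)
  also have "\<dots> = 2 * (1 - c) - t\<^sup>2"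
    unfolding W_norm(2) V_norm(2) inner_eq t_def using W_norm(1) V_norm(1)
    by (simp add: field_simps power2_eq_square)
  finally have t_le: "t\<^sup>2 / 2 \<le> 1 - c" by simp
  then have c_le: "0 \<le> 1 - c"
    using order_trans[OF _ t_le, of 0] by simp
  have "(flux \<xi> - flux \<eta>) \<bullet> (\<alpha> *\<^sub>R \<xi> - \<beta> *\<^sub>R \<eta>) =
     \<alpha> * ((\<xi> \<bullet> \<xi>) / W - (\<xi> \<bullet> \<eta>) / V) + \<beta> * ((\<eta> \<bullet> \<eta>) / V - (\<xi> \<bullet> \<eta>) / W)"
    using W_norm(1) V_norm(1) unfolding flux_eq
    by (simp add: inner_diff_left inner_diff_right inner_commute algebra_simps)
  also have "\<dots> = (\<alpha> * W + \<beta> * V) * (1 - c) - (\<alpha> - \<beta>) * t"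
    unfolding W_norm(2) V_norm(2) inner_eq t_def using W_norm(1) V_norm(1)
    by (simp add: field_simps power2_eq_square)
  also have "\<dots> \<ge> (\<alpha> + \<beta>) * (t\<^sup>2 / 2) - (\<alpha> - \<beta>) * t"
    using assms W_norm(1) V_norm(1) t_le c_le by (intro diff_right_mono mult_mono add_mono) auto
  also have "(\<alpha> + \<beta>) * (t\<^sup>2 / 2) - (\<alpha> - \<beta>) * t =
      ((\<alpha> + \<beta>) * t - (\<alpha> - \<beta>))\<^sup>2 / (2 * (\<alpha> + \<beta>)) - (\<alpha> - \<beta>)\<^sup>2 / (2 * (\<alpha> + \<beta>))"
  proof -
    have "s * (t\<^sup>2 / 2) - r * t = (s * t - r)\<^sup>2 / (2 * s) - r\<^sup>2 / (2 * s)" if "0 < s" for s r :: real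
      using that by (simp add: field_simps power2_eq_square)
    then show ?thesis using assms by (metis add_pos_pos)
  qed
  also have "\<dots> \<ge> - ((\<alpha> - \<beta>)\<^sup>2 / (2 * (\<alpha> + \<beta>)))"
    using assms by simp
  finally show ?thesis .
qed

subsection \<open>The signed power\<close>

lemma signed_pow_eq: "signed_pow q t = (max 0 t) powr q - (max 0 (- t)) powr q"
proof -
  have "\<bar>t\<bar> powr (q - 1) * \<bar>t\<bar> = \<bar>t\<bar> powr q"
    by (cases "t = 0") (auto simp: powr_diff)
  then show ?thesis
    by (cases "0 \<le> t") (auto simp: signed_pow_def max_def)
qed

lemma abs_signed_pow: "\<bar>signed_pow q t\<bar> = \<bar>t\<bar> powr q"
  by (simp add: signed_pow_eq max_def abs_if)

lemma signed_pow_measurable [measurable]: "signed_pow q \<in> borel_measurable borel"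
  unfolding signed_pow_def[abs_def] by measurable

lemma continuous_signed_pow: "0 < q \<Longrightarrow> continuous_on UNIV (signed_pow q)"
  unfolding signed_pow_eq[abs_def] by (intro continuous_intros continuous_on_powr') auto

lemma signed_pow_strict_mono:
  assumes "0 < q" shows "strict_mono (signed_pow q)"
proof (rule strict_monoI)
  fix v u :: real assume v_less_u: "v < u"
  consider "v < 0" | "0 \<le> v" by linarith
  then show "signed_pow q v < signed_pow q u"
  proof cases
    assume "v < 0"
    then have "(max 0 v) powr q \<le> (max 0 u) powr q" "(max 0 (- u)) powr q < (max 0 (- v)) powr q"
      using assms v_less_u by (auto intro!: powr_mono2 powr_less_mono2)
    then show ?thesis
      by (simp add: signed_pow_eq)
  next
    assume "0 \<le> v"
    then show ?thesis
      using assms v_less_u by (simp add: signed_pow_eq powr_less_mono2)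
  qed
qed

lemma signed_pow_inverse:
  assumes "q \<noteq> 0" shows "signed_pow q (signed_pow (1 / q) y) = y"
  using assms by (cases "0 \<le> y") (auto simp: signed_pow_eq max_def powr_powr)

lemma DERIV_signed_pow:
  assumes "t \<noteq> 0" shows "(signed_pow q has_real_derivative q * \<bar>t\<bar> powr (q - 1)) (at t)"
proof (cases "0 < t")
  case True
  have "(signed_pow q has_real_derivative q * t powr (q - 1)) (at t)"
    by (rule has_field_derivative_transform_within_open[OF has_real_derivative_powr[OF True],
        of "{0<..}"])
      (use True in \<open>auto simp: signed_pow_eq\<close>)
  with True show ?thesis
    by simp
next
  case False
  then have "((\<lambda>t. - ((- t) powr q)) has_real_derivative q * (- t) powr (q - 1)) (at t)"
    using assms by (auto intro!: derivative_eq_intros)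
  then have "(signed_pow q has_real_derivative q * (- t) powr (q - 1)) (at t)"
    by (rule has_field_derivative_transform_within_open[of _ _ _ "{..<0}"])
      (use False assms in \<open>auto simp: signed_pow_eq\<close>)
  with False show ?thesis
    by simp
qed

lemma powr_superadditive:
  fixes x y q :: real
  assumes "0 \<le> x" "0 \<le> y" "1 \<le> q"
  shows "x powr q + y powr q \<le> (x + y) powr q"
proof -
  have split: "z powr q = z * z powr (q - 1)" if "0 \<le> z" for z :: real
    using that by (cases "z = 0") (auto simp: powr_diff)
  have "x * x powr (q - 1) \<le> x * (x + y) powr (q - 1)"
    "y * y powr (q - 1) \<le> y * (x + y) powr (q - 1)"
    using assms by (auto intro!: mult_left_mono powr_mono2)
  then show ?thesis
    using split[of x] split[of y] split[of "x + y"] assms by (simp add: algebra_simps)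
qed

lemma signed_pow_diff_ge:
  assumes q_ge_1: "1 \<le> q" and "v \<le> u"
  shows "((u - v) / 2) powr q \<le> signed_pow q u - signed_pow q v"
proof -
  define a b where "a = max 0 u - max 0 v" and "b = max 0 (- v) - max 0 (- u)"
  have ab_split: "0 \<le> a" "0 \<le> b" "u - v = a + b"
    using \<open>v \<le> u\<close> by (auto simp: a_def b_def)
  have "((u - v) / 2) powr q \<le> (max a b) powr q"
    using ab_split q_ge_1 by (intro powr_mono2) auto
  also have "\<dots> \<le> a powr q + b powr q"
    by (simp add: max_def)
  also have "a powr q \<le> (max 0 u) powr q - (max 0 v) powr q"
    using powr_superadditive[of a "max 0 v" q] ab_split(1) q_ge_1 by (simp add: a_def)
  also have "b powr q \<le> (max 0 (- v)) powr q - (max 0 (- u)) powr q"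
    using powr_superadditive[of b "max 0 (- u)" q] ab_split(2) q_ge_1 by (simp add: b_def)
  finally show ?thesis
    by (simp add: signed_pow_eq)
qed

lemma signed_pow_Lp_loc:
  fixes u :: "'a::euclidean_space \<Rightarrow> real"
  assumes "u \<in> Lp_loc q" shows "(\<lambda>x. signed_pow q (u x)) \<in> Lp_loc 1"
  using assms measurable_compose[OF Lp_loc_measurable[OF assms] signed_pow_measurable]
  by (simp add: Lp_loc_def abs_signed_pow)

subsection \<open>Increasing transformations of the unknown\<close>

locale comparison_transform =
  fixes q K :: real and S \<rho> :: "real \<Rightarrow> real" and C :: real
  assumes q_pos: "0 < q" and C_pos: "0 < C"
    and DERIV_S: "(S has_real_derivative \<rho> t) (at t)" and continuous_\<rho>: "continuous_on UNIV \<rho>"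
    and \<rho>_pos: "0 < \<rho> t" and \<rho>_le_1: "\<rho> t \<le> 1"
    and \<rho>_diff_le: "v < u \<Longrightarrow>
      K * (\<rho> u - \<rho> v)\<^sup>2 \<le> (\<rho> u + \<rho> v) * ((signed_pow q u - signed_pow q v) * (S u - S v))"
    and S_diff_le: "v < u \<Longrightarrow> S u - S v \<le> C * (signed_pow q u - signed_pow q v) powr (min 1 (1 / q))"

lemma comparison_transform_ge_1:
  assumes q_ge_1: "1 \<le> q" shows "comparison_transform q K (\<lambda>t. t) (\<lambda>t. 1) 2"
proof
  fix u v :: real assume v_less_u: "v < u"
  have pos: "0 < signed_pow q u - signed_pow q v"
    using strict_monoD[OF signed_pow_strict_mono v_less_u] q_ge_1 by simp
  then show "K * (1 - 1)\<^sup>2 \<le> (1 + 1) * ((signed_pow q u - signed_pow q v) * (u - v))"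
    using v_less_u by simp
  have "(u - v) / 2 = (((u - v) / 2) powr q) powr (1 / q)"
    using v_less_u q_ge_1 by (simp add: powr_powr)
  also have "\<dots> \<le> (signed_pow q u - signed_pow q v) powr (1 / q)"
    using signed_pow_diff_ge[OF q_ge_1, of v u] v_less_u q_ge_1 by (intro powr_mono2) auto
  finally show "u - v \<le> 2 * (signed_pow q u - signed_pow q v) powr min 1 (1 / q)"
    using q_ge_1 by (simp add: min_absorb2)
qed (use q_ge_1 in auto)

lemma power2_diff_le_sqrt_diff:
  fixes a b :: real
  assumes "0 \<le> a" "0 \<le> b" shows "(a\<^sup>2 - b\<^sup>2)\<^sup>2 \<le> 2 * (a\<^sup>2 + b\<^sup>2) * (a - b)\<^sup>2"
proof -
  have "(a\<^sup>2 - b\<^sup>2)\<^sup>2 = (a + b)\<^sup>2 * (a - b)\<^sup>2"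
    by (simp add: power2_eq_square algebra_simps)
  also have "(a + b)\<^sup>2 \<le> 2 * (a\<^sup>2 + b\<^sup>2)"
    using sum_squares_ge_zero[of "a - b" 0] by (simp add: power2_eq_square algebra_simps)
  finally show ?thesis by (simp add: mult_right_mono)
qed

lemma antiderivative_exists:
  fixes f :: "real \<Rightarrow> real"
  assumes "continuous_on UNIV f" shows "\<exists>F. \<forall>x. (F has_real_derivative f x) (at x)"
  using einterval_antiderivative[of "-\<infinity>" \<infinity> f] assms
  by (simp add: continuous_on_eq_continuous_at has_real_derivative_iff_has_vector_derivative)

lemma mono_of_DERIV_nonneg_except_0:
  fixes f :: "real \<Rightarrow> real"
  assumes cont: "continuous_on UNIV f"
    and deriv: "\<And>t. t \<noteq> 0 \<Longrightarrow> \<exists>D. (f has_real_derivative D) (at t) \<and> 0 \<le> D"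
  shows "mono f"
proof (rule monoI)
  have mono_off_0: "f a \<le> f b" if "a \<le> b" "0 \<notin> {a<..<b}" for a b
  proof (rule DERIV_nonneg_imp_increasing_open[of a b f])
    show "\<exists>D. (f has_real_derivative D) (at t) \<and> 0 \<le> D" if "a < t" "t < b" for t
      using deriv[of t] \<open>0 \<notin> {a<..<b}\<close> that by auto
    show "continuous_on {a..b} f"
      using cont by (rule continuous_on_subset) simp
  qed fact
  fix v u :: real assume "v \<le> u"
  then show "f v \<le> f u"
    using mono_off_0[of v u] mono_off_0[of v 0] mono_off_0[of 0 u] by fastforce
qed

text \<open>The transformation for \<open>q < 1\<close> has derivative \<open>(quartic_weight q M)\<^sup>2\<close>.\<close>

definition quartic_weight :: "real \<Rightarrow> real \<Rightarrow> real \<Rightarrow> real" where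
  "quartic_weight q M t = (M + t\<^sup>2) powr ((q - 1) / 4)"

lemma quartic_weight_pos: "0 < M \<Longrightarrow> 0 < quartic_weight q M t"
  by (simp add: quartic_weight_def add_pos_nonneg less_imp_neq[symmetric])

lemma continuous_quartic_weight: "0 < M \<Longrightarrow> continuous_on UNIV (quartic_weight q M)"
  unfolding quartic_weight_def[abs_def]
  by (intro continuous_intros) (auto simp: add_pos_nonneg less_imp_neq[symmetric])

lemma quartic_weight_power2: "(quartic_weight q M t)\<^sup>2 = (M + t\<^sup>2) powr ((q - 1) / 2)"
proof -
  have "(q - 1) / 2 = (q - 1) / 4 + (q - 1) / 4" by simp
  then show ?thesis
    by (simp only: quartic_weight_def power2_eq_square powr_add)
qed

lemma quartic_weight_power2_le_1:
  assumes "q < 1" "1 \<le> M" shows "(quartic_weight q M t)\<^sup>2 \<le> 1"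
  using assms powr_mono2'[of "(q - 1) / 2" 1 "M + t\<^sup>2"]
  by (simp add: quartic_weight_power2 add_increasing2)

lemma quartic_weight_power2_le_powr:
  assumes "q < 1" "0 < M" "t \<noteq> 0" shows "(quartic_weight q M t)\<^sup>2 \<le> \<bar>t\<bar> powr (q - 1)"
proof -
  have "(quartic_weight q M t)\<^sup>2 \<le> (\<bar>t\<bar>\<^sup>2) powr ((q - 1) / 2)"
    unfolding quartic_weight_power2 using assms by (intro powr_mono2') auto
  also have "\<dots> = \<bar>t\<bar> powr (q - 1)"
    using assms(3) powr_realpow[of "\<bar>t\<bar>" 2] powr_powr[of "\<bar>t\<bar>" 2 "(q - 1) / 2"]
    by (simp add: diff_divide_distrib)
  finally show ?thesis .
qed

lemma DERIV_quartic_weight: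
  assumes q_bounds: "0 < q" "q < 1" and M_ge_1: "1 \<le> M"
  obtains D where "(quartic_weight q M has_real_derivative D) (at t)"
    "\<bar>D\<bar> \<le> M powr (- 1 / 4) / 2 * (quartic_weight q M t)\<^sup>2"
proof
  define y where "y = M + t\<^sup>2"
  have "M \<le> y" by (simp add: y_def)
  with M_ge_1 have y_ge: "M \<le> y" "1 \<le> y" "0 < y" by auto
  show "(quartic_weight q M has_real_derivative (q - 1) / 4 * y powr ((q - 1) / 4 - 1) * (2 * t))
      (at t)"
    using y_ge(3) unfolding quartic_weight_def[abs_def] y_def
    by (auto intro!: derivative_eq_intros)
  have t_le: "\<bar>t\<bar> \<le> y powr (1 / 2)"
    using real_sqrt_le_mono[of "t\<^sup>2" y] M_ge_1 by (simp add: y_def powr_half_sqrt)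
  have "\<bar>(q - 1) / 4 * y powr ((q - 1) / 4 - 1) * (2 * t)\<bar> =
      (1 - q) / 2 * (y powr ((q - 1) / 4 - 1) * \<bar>t\<bar>)"
    using q_bounds by (simp add: abs_mult)
  also have "\<dots> \<le> 1 / 2 * (y powr ((q - 1) / 4 - 1) * y powr (1 / 2))"
    using q_bounds t_le by (intro mult_mono mult_left_mono) auto
  also have "y powr ((q - 1) / 4 - 1) * y powr (1 / 2) =
      y powr (- (q + 1) / 4) * (quartic_weight q M t)\<^sup>2"
  proof -
    have "(q - 1) / 4 - 1 + 1 / 2 = - (q + 1) / 4 + (q - 1) / 2"
      by (simp add: field_simps)
    then show ?thesis
      by (simp only: quartic_weight_power2 flip: y_def powr_add)
  qed
  also have "y powr (- (q + 1) / 4) \<le> y powr (- 1 / 4)"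
    using q_bounds y_ge by (intro powr_mono) auto
  also have "\<dots> \<le> M powr (- 1 / 4)"
    using M_ge_1 y_ge by (intro powr_mono2') auto
  finally show "\<bar>(q - 1) / 4 * y powr ((q - 1) / 4 - 1) * (2 * t)\<bar> \<le>
      M powr (- 1 / 4) / 2 * (quartic_weight q M t)\<^sup>2"
    by (simp add: mult_right_mono)
qed

context
  fixes q M :: real and S :: "real \<Rightarrow> real"
  assumes q_bounds: "0 < q" "q < 1" and M_ge_1: "1 \<le> M"
    and S_deriv: "\<And>t. (S has_real_derivative (quartic_weight q M t)\<^sup>2) (at t)"
begin

lemma quartic_antiderivative_less:
  assumes "v < u" shows "S v < S u"
proof (rule DERIV_pos_imp_increasing[OF assms])
  show "\<exists>y. (S has_real_derivative y) (at t) \<and> 0 < y" for t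
    using S_deriv[of t] quartic_weight_pos[of M q t] M_ge_1
    by (intro exI[of _ "(quartic_weight q M t)\<^sup>2"]) simp
qed

lemma quartic_antiderivative_le_signed_pow:
  assumes "v < u" shows "q * (S u - S v) \<le> signed_pow q u - signed_pow q v"
proof -
  have "mono (\<lambda>t. signed_pow q t - q * S t)"
  proof (rule mono_of_DERIV_nonneg_except_0)
    have "continuous_on UNIV S"
      using S_deriv by (rule DERIV_continuous_on)
    then show "continuous_on UNIV (\<lambda>t. signed_pow q t - q * S t)"
      using continuous_signed_pow[OF q_bounds(1)]
      by (intro continuous_on_diff continuous_on_mult continuous_on_const)
    fix t :: real assume t_nonzero: "t \<noteq> 0"
    have "((\<lambda>t. signed_pow q t - q * S t) has_real_derivative
        q * \<bar>t\<bar> powr (q - 1) - q * (quartic_weight q M t)\<^sup>2) (at t)"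
      by (intro DERIV_diff DERIV_signed_pow[OF t_nonzero] DERIV_cmult S_deriv)
    moreover have "0 \<le> q * \<bar>t\<bar> powr (q - 1) - q * (quartic_weight q M t)\<^sup>2"
      using quartic_weight_power2_le_powr[OF q_bounds(2) _ t_nonzero] q_bounds(1) M_ge_1 by simp
    ultimately show "\<exists>D. ((\<lambda>t. signed_pow q t - q * S t) has_real_derivative D) (at t) \<and> 0 \<le> D"
      by blast
  qed
  from monoD[OF this, of v u] assms show ?thesis by (simp add: algebra_simps)
qed

lemma quartic_weight_diff_le:
  assumes "v < u"
  shows "\<bar>quartic_weight q M u - quartic_weight q M v\<bar> \<le> M powr (- 1 / 4) / 2 * (S u - S v)"
proof -
  define c where "c = M powr (- 1 / 4) / 2"
  define r where "r = quartic_weight q M"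
  have "c * S v + \<sigma> * r v \<le> c * S u + \<sigma> * r u" if abs_\<sigma>: "\<bar>\<sigma>\<bar> = 1" for \<sigma>
  proof (rule DERIV_nonneg_imp_nondecreasing[of v u "\<lambda>t. c * S t + \<sigma> * r t"])
    fix t
    obtain D where D_deriv: "(r has_real_derivative D) (at t)" "\<bar>D\<bar> \<le> c * (r t)\<^sup>2"
      unfolding r_def c_def by (rule DERIV_quartic_weight[OF q_bounds M_ge_1])
    have "((\<lambda>t. c * S t + \<sigma> * r t) has_real_derivative c * (r t)\<^sup>2 + \<sigma> * D) (at t)"
      unfolding r_def using D_deriv(1) by (intro DERIV_add DERIV_cmult S_deriv) (simp add: r_def)
    moreover have "0 \<le> c * (r t)\<^sup>2 + \<sigma> * D"
      using D_deriv(2) abs_\<sigma> abs_mult[of \<sigma> D] by simp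
    ultimately show "\<exists>y. ((\<lambda>t. c * S t + \<sigma> * r t) has_real_derivative y) (at t) \<and> 0 \<le> y"
      by blast
  qed (use assms in simp)
  from this[of 1] this[of "- 1"] show ?thesis
    unfolding c_def[symmetric] r_def[symmetric] by (simp add: right_diff_distrib abs_le_iff)
qed

lemma quartic_weight_power2_diff_le:
  assumes v_less_u: "v < u" and K_le: "K \<le> q * sqrt M"
  defines "\<rho> \<equiv> \<lambda>t. (quartic_weight q M t)\<^sup>2"
  shows "K * (\<rho> u - \<rho> v)\<^sup>2 \<le> (\<rho> u + \<rho> v) * ((signed_pow q u - signed_pow q v) * (S u - S v))"
proof -
  define c where "c = M powr (- 1 / 4) / 2"
  define r where "r = quartic_weight q M"
  have "sqrt M * (M powr (- 1 / 4))\<^sup>2 = 1"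
    using M_ge_1 by (simp add: power2_eq_square flip: powr_half_sqrt powr_add)
  then have c_power2: "sqrt M * c\<^sup>2 * 2 = 1 / 2"
    by (simp add: c_def power_divide)
  have r_nonneg: "0 \<le> r t" for t
    using M_ge_1 by (simp add: r_def quartic_weight_pos less_imp_le)
  note S_less = quartic_antiderivative_less[OF v_less_u]
    and S_le = quartic_antiderivative_le_signed_pow[OF v_less_u]
  have "K * ((r u)\<^sup>2 - (r v)\<^sup>2)\<^sup>2 \<le> q * sqrt M * ((r u)\<^sup>2 - (r v)\<^sup>2)\<^sup>2"
    using K_le by (rule mult_right_mono) simp
  also have "\<dots> \<le> q * sqrt M * (2 * ((r u)\<^sup>2 + (r v)\<^sup>2) * (r u - r v)\<^sup>2)"
    using q_bounds M_ge_1 r_nonneg by (intro mult_left_mono power2_diff_le_sqrt_diff) auto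
  also have "\<dots> \<le> q * sqrt M * (2 * ((r u)\<^sup>2 + (r v)\<^sup>2) * (c * (S u - S v))\<^sup>2)"
    using q_bounds M_ge_1 quartic_weight_diff_le[OF v_less_u]
      power_mono[of "\<bar>r u - r v\<bar>" "c * (S u - S v)" 2]
    by (intro mult_left_mono) (auto simp: c_def r_def)
  also have "\<dots> = (sqrt M * c\<^sup>2 * 2) * (((r u)\<^sup>2 + (r v)\<^sup>2) * (q * (S u - S v) * (S u - S v)))"
    by (simp add: power2_eq_square)
  also have "\<dots> \<le> ((r u)\<^sup>2 + (r v)\<^sup>2) * (q * (S u - S v) * (S u - S v))"
    unfolding c_power2 using q_bounds S_less by simp
  also have "\<dots> \<le> ((r u)\<^sup>2 + (r v)\<^sup>2) * ((signed_pow q u - signed_pow q v) * (S u - S v))"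
    using S_le S_less by (intro mult_left_mono mult_right_mono) auto
  finally show ?thesis
    by (simp add: \<rho>_def r_def)
qed

lemma comparison_transform_quartic:
  assumes K_le: "K \<le> q * sqrt M"
  shows "comparison_transform q K S (\<lambda>t. (quartic_weight q M t)\<^sup>2) (1 / q)"
proof
  show "continuous_on UNIV (\<lambda>t. (quartic_weight q M t)\<^sup>2)"
    using M_ge_1 by (intro continuous_on_power continuous_quartic_weight) simp
  show "0 < (quartic_weight q M t)\<^sup>2" "(quartic_weight q M t)\<^sup>2 \<le> 1"
    "(S has_real_derivative (quartic_weight q M t)\<^sup>2) (at t)" for t
    using quartic_weight_pos[of M q t] quartic_weight_power2_le_1[OF q_bounds(2) M_ge_1]
      S_deriv M_ge_1 by simp_all
  fix u v :: real assume v_less_u: "v < u"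
  show "K * ((quartic_weight q M u)\<^sup>2 - (quartic_weight q M v)\<^sup>2)\<^sup>2 \<le>
      ((quartic_weight q M u)\<^sup>2 + (quartic_weight q M v)\<^sup>2) *
      ((signed_pow q u - signed_pow q v) * (S u - S v))"
    by (rule quartic_weight_power2_diff_le[OF v_less_u K_le])
  show "S u - S v \<le> 1 / q * (signed_pow q u - signed_pow q v) powr min 1 (1 / q)"
    using quartic_antiderivative_le_signed_pow[OF v_less_u] q_bounds
      strict_monoD[OF signed_pow_strict_mono[OF q_bounds(1)] v_less_u]
    by (simp add: min_def field_simps)
qed (use q_bounds in auto)

end

lemma comparison_transform_exists:
  assumes "0 < q" shows "\<exists>S \<rho> C. comparison_transform q K S \<rho> C"
proof (cases "q < 1")
  case True
  define M where "M = 1 + (K / q)\<^sup>2"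
  have M_ge_1: "1 \<le> M" by (simp add: M_def)
  have "K / q \<le> sqrt M"
    by (rule real_le_rsqrt) (simp add: M_def)
  then have K_le: "K \<le> q * sqrt M"
    using assms by (simp add: field_simps)
  have "continuous_on UNIV (\<lambda>t. (quartic_weight q M t)\<^sup>2)"
    using M_ge_1 by (intro continuous_on_power continuous_quartic_weight) simp
  then obtain S where "\<And>t. (S has_real_derivative (quartic_weight q M t)\<^sup>2) (at t)"
    using antiderivative_exists by blast
  from comparison_transform_quartic[OF assms True M_ge_1 this K_le] show ?thesis by blast
next
  case False
  then show ?thesis
    using comparison_transform_ge_1[of q K] by force
qed

subsection \<open>A smooth truncation vanishing to order \<open>k\<close>\<close>

definition trunc :: "nat \<Rightarrow> real \<Rightarrow> real" where
  "trunc k z = (max 0 z) ^ k / (1 + (max 0 z) ^ k)"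

definition trunc_deriv :: "nat \<Rightarrow> real \<Rightarrow> real" where
  "trunc_deriv k z = real k * (max 0 z) ^ (k - 1) / (1 + (max 0 z) ^ k)\<^sup>2"

lemma one_plus_max_power_pos: "0 < 1 + (max 0 z) ^ k" for z :: real
  by (simp add: add_pos_nonneg)

lemma DERIV_trunc:
  assumes "2 \<le> k" shows "(trunc k has_real_derivative trunc_deriv k z) (at z)"
proof -
  have "1 + (max 0 z) ^ k \<noteq> 0"
    using one_plus_max_power_pos[of z k] by simp
  from DERIV_divide[OF DERIV_max_0_power[OF assms, of z]
      DERIV_add[OF DERIV_const DERIV_max_0_power[OF assms, of z]] this]
  show ?thesis
    unfolding trunc_def[abs_def] trunc_deriv_def by (simp add: power2_eq_square algebra_simps)
qed

lemma continuous_trunc_deriv: "continuous_on UNIV (trunc_deriv k)"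
  unfolding trunc_deriv_def[abs_def]
  using one_plus_max_power_pos[of _ k]
  by (intro continuous_intros) (auto simp: less_imp_neq[symmetric])

lemma trunc_measurable [measurable]: "trunc k \<in> borel_measurable borel"
  unfolding trunc_def[abs_def] by measurable

lemma trunc_nonneg: "0 \<le> trunc k z"
  using one_plus_max_power_pos[of z k] by (simp add: trunc_def)

lemma trunc_le_1: "trunc k z \<le> 1"
  using one_plus_max_power_pos[of z k] by (simp add: trunc_def divide_le_eq_1)

lemma trunc_le_power: "0 \<le> z \<Longrightarrow> trunc k z \<le> z ^ k"
  using one_plus_max_power_pos[of z k] by (simp add: trunc_def divide_le_eq algebra_simps)

lemma trunc_pos: "0 < z \<Longrightarrow> 0 < trunc k z"
  using one_plus_max_power_pos[of z k] by (simp add: trunc_def)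

lemma trunc_eq_0: "0 < k \<Longrightarrow> z \<le> 0 \<Longrightarrow> trunc k z = 0"
  by (simp add: trunc_def max_def zero_power)

lemma trunc_deriv_nonneg: "0 \<le> trunc_deriv k z"
  by (simp add: trunc_deriv_def)

lemma trunc_deriv_eq_0: "2 \<le> k \<Longrightarrow> z \<le> 0 \<Longrightarrow> trunc_deriv k z = 0"
  by (simp add: trunc_deriv_def max_def zero_power)

lemma trunc_deriv_le: "trunc_deriv k z \<le> real k"
proof -
  define y where "y = max 0 z"
  have y_nonneg: "0 \<le> y" by (simp add: y_def)
  have "y ^ (k - 1) \<le> 1 + y ^ k"
  proof (cases "y \<le> 1")
    case True
    then have "y ^ (k - 1) \<le> 1" using y_nonneg by (simp add: power_le_one)
    then show ?thesis using y_nonneg zero_le_power[of y k] by linarith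
  next
    case False
    then have "y ^ (k - 1) \<le> y ^ k" by (intro power_increasing) auto
    then show ?thesis by simp
  qed
  also have "\<dots> \<le> (1 + y ^ k)\<^sup>2"
    using y_nonneg by (simp add: power2_eq_square algebra_simps)
  finally have "y ^ (k - 1) / (1 + y ^ k)\<^sup>2 \<le> 1"
    using y_nonneg by (simp add: divide_le_eq_1 add_pos_nonneg)
  from mult_left_mono[OF this, of "real k"] show ?thesis
    by (simp add: trunc_deriv_def y_def)
qed

lemma mult_trunc_deriv_le:
  assumes "0 < z" "0 < k" shows "z * trunc_deriv k z \<le> real k * trunc k z"
proof -
  have "z * trunc_deriv k z = real k * (z ^ k / (1 + z ^ k)\<^sup>2)"
    using assms power_minus_mult[of k z] by (simp add: trunc_deriv_def mult_ac)
  also have "\<dots> \<le> real k * (z ^ k / (1 + z ^ k))"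
    using assms
    by (intro mult_left_mono divide_left_mono) (auto simp: power2_eq_square add_pos_nonneg)
  finally show ?thesis using assms by (simp add: trunc_def)
qed

context comparison_transform
begin

lemma S_less: "v < u \<Longrightarrow> S v < S u"
  using DERIV_pos_imp_increasing[of v u S] DERIV_S \<rho>_pos by blast

lemma S_continuous: "continuous_on UNIV S"
  using DERIV_S by (rule DERIV_continuous_on)

lemma signed_pow_less: "v < u \<Longrightarrow> signed_pow q v < signed_pow q u"
  by (rule strict_monoD[OF signed_pow_strict_mono[OF q_pos]])

lemma trunc_deriv_flux_ge:
  fixes \<xi> \<eta> :: "'a::euclidean_space"
  assumes k_ge_2: "2 \<le> k" and K_ge: "2 * real k \<le> K" and v_less_u: "v < u"
  shows "- ((signed_pow q u - signed_pow q v) * trunc k (S u - S v) / 4) \<le>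
    trunc_deriv k (S u - S v) * ((flux \<xi> - flux \<eta>) \<bullet> (\<rho> u *\<^sub>R \<xi> - \<rho> v *\<^sub>R \<eta>))"
proof -
  define f z where "f = signed_pow q u - signed_pow q v" and "z = S u - S v"
  have f_pos: "0 < f" and z_pos: "0 < z"
    using signed_pow_less[OF v_less_u] S_less[OF v_less_u] by (simp_all add: f_def z_def)
  have "2 * real k * (\<rho> u - \<rho> v)\<^sup>2 \<le> K * (\<rho> u - \<rho> v)\<^sup>2"
    using K_ge by (rule mult_right_mono) simp
  also have "\<dots> \<le> (\<rho> u + \<rho> v) * (f * z)"
    using \<rho>_diff_le[OF v_less_u] by (simp add: f_def z_def)
  finally have "(\<rho> u - \<rho> v)\<^sup>2 / (2 * (\<rho> u + \<rho> v)) \<le> f * z / (4 * real k)"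
    using k_ge_2 \<rho>_pos[of u] \<rho>_pos[of v] by (simp add: field_simps)
  then have "- (f * z / (4 * real k)) \<le> (flux \<xi> - flux \<eta>) \<bullet> (\<rho> u *\<^sub>R \<xi> - \<rho> v *\<^sub>R \<eta>)"
    using flux_weighted_monotone[OF \<rho>_pos \<rho>_pos, of u v \<xi> \<eta>] by linarith
  then have "trunc_deriv k z * (- (f * z / (4 * real k))) \<le>
      trunc_deriv k z * ((flux \<xi> - flux \<eta>) \<bullet> (\<rho> u *\<^sub>R \<xi> - \<rho> v *\<^sub>R \<eta>))"
    using trunc_deriv_nonneg by (rule mult_left_mono)
  moreover have "f / (4 * real k) * (z * trunc_deriv k z) \<le> f / (4 * real k) * (real k * trunc k z)"
    using f_pos k_ge_2 mult_trunc_deriv_le[OF z_pos, of k] by (intro mult_left_mono) auto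
  ultimately show ?thesis
    using k_ge_2 by (simp add: f_def[symmetric] z_def[symmetric] mult_ac)
qed

lemma trunc_le_absorbed:
  assumes \<epsilon>_pos: "0 < \<epsilon>" and v_less_u: "v < u"
  shows "2 * \<epsilon> * trunc k (S u - S v) \<le> (signed_pow q u - signed_pow q v) * trunc k (S u - S v) / 4
    + 2 * \<epsilon> * (C * (8 * \<epsilon>) powr min 1 (1 / q)) ^ k"
proof -
  define f z where "f = signed_pow q u - signed_pow q v" and "z = S u - S v"
  define E where "E = C * (8 * \<epsilon>) powr min 1 (1 / q)"
  have f_pos: "0 < f" and z_pos: "0 < z" and E_nonneg: "0 \<le> E"
    using signed_pow_less[OF v_less_u] S_less[OF v_less_u] C_pos
    by (simp_all add: f_def z_def E_def)
  have "2 * \<epsilon> * trunc k z \<le> f * trunc k z / 4 + 2 * \<epsilon> * E ^ k"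
  proof (cases "8 * \<epsilon> \<le> f")
    case True
    have "8 * \<epsilon> * trunc k z \<le> f * trunc k z"
      using True trunc_nonneg by (rule mult_right_mono)
    moreover have "0 \<le> 2 * \<epsilon> * E ^ k" using E_nonneg \<epsilon>_pos by simp
    ultimately show ?thesis by linarith
  next
    case False
    have "z \<le> C * f powr min 1 (1 / q)"
      using S_diff_le[OF v_less_u] by (simp add: f_def z_def)
    also have "\<dots> \<le> E"
      unfolding E_def using False f_pos q_pos C_pos by (intro mult_left_mono powr_mono2) auto
    finally have "trunc k z \<le> E ^ k"
      using trunc_le_power[of z k] power_mono[of z E k] z_pos by linarith
    then have "2 * \<epsilon> * trunc k z \<le> 2 * \<epsilon> * E ^ k" using \<epsilon>_pos by simp
    moreover have "0 \<le> f * trunc k z" using f_pos trunc_nonneg by simp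
    ultimately show ?thesis by linarith
  qed
  then show ?thesis by (simp add: f_def z_def E_def)
qed

lemma truncated_flux_bound:
  fixes \<xi> \<eta> :: "'a::euclidean_space" and u v :: real
  assumes k_ge_2: "2 \<le> k" and K_ge: "2 * real k \<le> K" and \<epsilon>_pos: "0 < \<epsilon>"
  defines "T \<equiv> trunc k (S u - S v)"
  shows "(signed_pow q u - signed_pow q v) * T / 2 - 2 * \<epsilon> * (C * (8 * \<epsilon>) powr min 1 (1 / q)) ^ k \<le>
    trunc_deriv k (S u - S v) * ((flux \<xi> - flux \<eta>) \<bullet> (\<rho> u *\<^sub>R \<xi> - \<rho> v *\<^sub>R \<eta>))
      + (signed_pow q u - signed_pow q v) * T - 2 * \<epsilon> * T"
proof (cases "v < u")
  case True
  show ?thesis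
    unfolding T_def
    using trunc_deriv_flux_ge[OF k_ge_2 K_ge True, of \<xi> \<eta>] trunc_le_absorbed[OF \<epsilon>_pos True, of k]
    by linarith
next
  case False
  then have "S u - S v \<le> 0"
    using S_less[of u v] by (cases "u = v") auto
  then show ?thesis
    using k_ge_2 C_pos \<epsilon>_pos by (simp add: T_def trunc_eq_0 trunc_deriv_eq_0)
qed

end

subsection \<open>The comparison principle\<close>

definition solves :: "real \<Rightarrow> ('a::euclidean_space \<Rightarrow> real) \<Rightarrow> ('a \<Rightarrow> real) \<Rightarrow> ('a \<Rightarrow> 'a) \<Rightarrow> bool" where
  "solves q h u g \<longleftrightarrow> u \<in> Lp_loc q \<and> (\<forall>r. strong_grad_on (cball 0 r) u g) \<and>
     (\<forall>\<phi>\<in>C1_0. (\<integral>x. flux (g x) \<bullet> grad \<phi> x \<partial>lebesgue) + (\<integral>x. signed_pow q (u x) * \<phi> x \<partial>lebesgue)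
        = (\<integral>x. h x * \<phi> x \<partial>lebesgue))"

lemma solves_Lp_loc: "solves q h u g \<Longrightarrow> u \<in> Lp_loc q"
  by (simp add: solves_def)

lemma solves_strong_grad_on: "solves q h u g \<Longrightarrow> strong_grad_on (cball 0 r) u g"
  by (simp add: solves_def)

lemma weak_solution_imp_solves:
  assumes "weak_solution q h u" shows "solves q h u (weak_grad u)"
proof -
  have u_loc: "u \<in> Lp_loc 1" and "\<exists>g. is_weak_grad u g"
    using assms by (auto simp: weak_solution_def W11_loc_def)
  then have "is_weak_grad u (weak_grad u)"
    unfolding weak_grad_def by (simp add: someI_ex)
  then show ?thesis
    using assms weak_grad_imp_strong_grad_on[OF u_loc]
    by (simp add: solves_def weak_solution_def flux_def divide_inverse mult.commute)
qed

lemma const_solves: "solves q (\<lambda>x. signed_pow q c) (\<lambda>x. c) (\<lambda>x. 0)"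
  by (simp add: solves_def Lp_loc_const strong_grad_on_const flux_def)

lemma solves_weak_form_on_cball:
  fixes u :: "'a::euclidean_space \<Rightarrow> real"
  assumes u_solves: "solves q h u g" and h_loc: "h \<in> Lp_loc 1"
    and \<psi>_supported: "\<psi> \<in> C1_supported_in (cball 0 r)"
  defines "M \<equiv> lebesgue_on (cball (0::'a) r)"
  shows "integrable M (\<lambda>x. flux (g x) \<bullet> grad \<psi> x)"
    "integrable M (\<lambda>x. \<psi> x * (signed_pow q (u x) - h x))"
    "(\<integral>x. flux (g x) \<bullet> grad \<psi> x \<partial>M) + (\<integral>x. \<psi> x * (signed_pow q (u x) - h x) \<partial>M) = 0"
proof -
  note C1 = C1_supported_in_is_C1[OF \<psi>_supported]
  show "integrable M (\<lambda>x. flux (g x) \<bullet> grad \<psi> x)"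
    unfolding M_def
    using is_C1_continuous_grad[OF C1] norm_flux_le_1
      strong_grad_on_measurable(2)[OF solves_strong_grad_on[OF u_solves]]
    by (intro integrable_bounded_bilinear[OF bounded_bilinear_inner, where C = 1]
        continuous_imp_integrable_lebesgue_on_cball measurable_compose[OF _ flux_measurable]) auto
  note integrable_\<psi> = Lp_loc_1_integrable_C1_supported_mult[OF \<psi>_supported]
  note integrable = integrable_\<psi>[OF signed_pow_Lp_loc[OF solves_Lp_loc[OF u_solves]]]
    integrable_\<psi>[OF h_loc]
  then show "integrable M (\<lambda>x. \<psi> x * (signed_pow q (u x) - h x))"
    unfolding M_def using C1_supported_in_eq_0[OF \<psi>_supported]
    by (subst integrable_lebesgue_on_vanishing) (auto simp: right_diff_distrib)
  have "(\<integral>x. flux (g x) \<bullet> grad \<psi> x \<partial>lebesgue) + (\<integral>x. \<psi> x * signed_pow q (u x) \<partial>lebesgue) =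
      (\<integral>x. \<psi> x * h x \<partial>lebesgue)"
    using u_solves C1_supported_in_C1_0[OF \<psi>_supported] by (simp add: solves_def mult.commute)
  then have "(\<integral>x. flux (g x) \<bullet> grad \<psi> x \<partial>lebesgue) +
      (\<integral>x. \<psi> x * (signed_pow q (u x) - h x) \<partial>lebesgue) = 0"
    using integrable by (simp add: right_diff_distrib)
  moreover have "(\<integral>x. flux (g x) \<bullet> grad \<psi> x \<partial>M) = (\<integral>x. flux (g x) \<bullet> grad \<psi> x \<partial>lebesgue)"
    unfolding M_def using C1_supported_in_grad_eq_0[OF \<psi>_supported]
    by (intro integral_lebesgue_on_vanishing) auto
  moreover have "(\<integral>x. \<psi> x * (signed_pow q (u x) - h x) \<partial>M) =
      (\<integral>x. \<psi> x * (signed_pow q (u x) - h x) \<partial>lebesgue)"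
    unfolding M_def using C1_supported_in_eq_0[OF \<psi>_supported]
    by (intro integral_lebesgue_on_vanishing) auto
  ultimately show
    "(\<integral>x. flux (g x) \<bullet> grad \<psi> x \<partial>M) + (\<integral>x. \<psi> x * (signed_pow q (u x) - h x) \<partial>M) = 0"
    by simp
qed

locale comparison_pair = comparison_transform q K S \<rho> C for q K S \<rho> C +
  fixes k :: nat and u v h1 h2 :: "'a::euclidean_space \<Rightarrow> real" and gu gv :: "'a \<Rightarrow> 'a"
  assumes k_ge_2: "2 \<le> k" and K_ge: "2 * real k \<le> K"
    and u_solves: "solves q h1 u gu" and v_solves: "solves q h2 v gv"
    and h_ordered: "h1 \<in> Lp_loc 1" "h2 \<in> Lp_loc 1" "AE x in lebesgue. h1 x \<le> h2 x"
begin

definition flux_diff :: "'a \<Rightarrow> 'a" where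
  "flux_diff x = flux (gu x) - flux (gv x)"

definition power_diff :: "'a \<Rightarrow> real" where
  "power_diff x = signed_pow q (u x) - signed_pow q (v x)"

definition transform_diff :: "'a \<Rightarrow> real" where
  "transform_diff x = S (u x) - S (v x)"

definition transform_grad :: "'a \<Rightarrow> 'a" where
  "transform_grad x = \<rho> (u x) *\<^sub>R gu x - \<rho> (v x) *\<^sub>R gv x"

definition excess :: "'a \<Rightarrow> real" where
  "excess x = power_diff x * trunc k (transform_diff x)"

lemma norm_flux_diff_le: "norm (flux_diff x) \<le> 2"
  unfolding flux_diff_def
  using norm_triangle_ineq4[of "flux (gu x)" "flux (gv x)"] norm_flux_le_1[of "gu x"]
    norm_flux_le_1[of "gv x"]
  by linarith

lemma flux_diff_measurable: "flux_diff \<in> borel_measurable (lebesgue_on (cball 0 r))"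
  unfolding flux_diff_def[abs_def]
  by (intro borel_measurable_diff measurable_compose[OF _ flux_measurable]
      strong_grad_on_measurable(2)[OF solves_strong_grad_on[OF u_solves]]
      strong_grad_on_measurable(2)[OF solves_strong_grad_on[OF v_solves]])

lemma power_diff_Lp_loc:
  "(\<lambda>x. signed_pow q (u x)) \<in> Lp_loc 1" "(\<lambda>x. signed_pow q (v x)) \<in> Lp_loc 1"
  by (rule signed_pow_Lp_loc[OF solves_Lp_loc[OF u_solves]]
      signed_pow_Lp_loc[OF solves_Lp_loc[OF v_solves]])+

lemma integrable_power_diff: "integrable (lebesgue_on (cball 0 r)) power_diff"
  unfolding power_diff_def[abs_def]
  by (intro Bochner_Integration.integrable_diff Lp_loc_1_integrable_on_cball power_diff_Lp_loc)

lemma strong_grad_on_transform_diff: "strong_grad_on (cball 0 r) transform_diff transform_grad"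
  unfolding transform_diff_def[abs_def] transform_grad_def[abs_def]
  using \<rho>_pos \<rho>_le_1
  by (intro strong_grad_on_diff strong_grad_on_compose[OF _ DERIV_S continuous_\<rho>, where C = 1]
      solves_strong_grad_on[OF u_solves] solves_strong_grad_on[OF v_solves])
    (simp_all add: abs_of_pos)

lemma excess_measurable: "excess \<in> borel_measurable lebesgue"
proof -
  have [measurable]: "S \<in> borel_measurable borel"
    by (rule borel_measurable_continuous_onI[OF S_continuous])
  have [measurable]: "u \<in> borel_measurable lebesgue" "v \<in> borel_measurable lebesgue"
    using Lp_loc_measurable[OF solves_Lp_loc[OF u_solves]]
      Lp_loc_measurable[OF solves_Lp_loc[OF v_solves]] .
  show ?thesis
    unfolding excess_def[abs_def] power_diff_def transform_diff_def by measurable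
qed

lemma excess_nonneg: "0 \<le> excess x"
proof (cases "v x < u x")
  case True
  then show ?thesis
    using signed_pow_less[OF True] trunc_nonneg by (simp add: excess_def power_diff_def)
next
  case False
  then have "transform_diff x \<le> 0"
    using S_less[of "u x" "v x"] by (cases "u x = v x") (auto simp: transform_diff_def)
  then show ?thesis using k_ge_2 by (simp add: excess_def trunc_eq_0)
qed

lemma excess_pos: "v x < u x \<Longrightarrow> 0 < excess x"
  by (simp add: excess_def power_diff_def transform_diff_def signed_pow_less S_less trunc_pos)

lemma weak_form_diff:
  assumes \<psi>_supported: "\<psi> \<in> C1_supported_in (cball 0 r)"
  defines "M \<equiv> lebesgue_on (cball 0 r)"
  shows "(\<integral>x. flux_diff x \<bullet> grad \<psi> x \<partial>M) + (\<integral>x. \<psi> x * (power_diff x - (h1 x - h2 x)) \<partial>M) = 0"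
proof -
  note form_u = solves_weak_form_on_cball[OF u_solves h_ordered(1) \<psi>_supported, folded M_def]
    and form_v = solves_weak_form_on_cball[OF v_solves h_ordered(2) \<psi>_supported, folded M_def]
  have "flux_diff x \<bullet> grad \<psi> x = flux (gu x) \<bullet> grad \<psi> x - flux (gv x) \<bullet> grad \<psi> x"
    "\<psi> x * (power_diff x - (h1 x - h2 x)) =
      \<psi> x * (signed_pow q (u x) - h1 x) - \<psi> x * (signed_pow q (v x) - h2 x)" for x
    by (simp_all add: flux_diff_def power_diff_def inner_diff_left algebra_simps)
  then show ?thesis
    using form_u form_v by simp
qed

definition tested_integrand :: "('a \<Rightarrow> real) \<Rightarrow> 'a \<Rightarrow> real" where
  "tested_integrand \<phi> x = flux_diff x \<bullet> (trunc k (transform_diff x) *\<^sub>R grad \<phi> x +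
      (\<phi> x * trunc_deriv k (transform_diff x)) *\<^sub>R transform_grad x) +
    trunc k (transform_diff x) * \<phi> x * (power_diff x - (h1 x - h2 x))"

lemma
  assumes \<phi>_supported: "\<phi> \<in> C1_supported_in (cball 0 r)"
  shows integrable_tested_integrand: "integrable (lebesgue_on (cball 0 r)) (tested_integrand \<phi>)"
    and integral_tested_integrand: "(\<integral>x. tested_integrand \<phi> x \<partial>lebesgue_on (cball 0 r)) = 0"
proof -
  have integrable_b: "integrable (lebesgue_on (cball 0 r)) (\<lambda>x. power_diff x - (h1 x - h2 x))"
    using h_ordered(1,2)
    by (intro Bochner_Integration.integrable_diff integrable_power_diff
        Lp_loc_1_integrable_on_cball)
  have bounds: "\<bar>trunc k t\<bar> \<le> real k" "\<bar>trunc_deriv k t\<bar> \<le> real k" for t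
    using trunc_nonneg[of k t] trunc_le_1[of k t] trunc_deriv_nonneg[of k t] trunc_deriv_le[of k t]
      k_ge_2 by auto
  note tested = strong_grad_on_truncated_test[OF strong_grad_on_transform_diff \<phi>_supported
      DERIV_trunc[OF k_ge_2] continuous_trunc_deriv bounds flux_diff_measurable norm_flux_diff_le
      integrable_b ballI[OF weak_form_diff]]
  show "integrable (lebesgue_on (cball 0 r)) (tested_integrand \<phi>)"
    "(\<integral>x. tested_integrand \<phi> x \<partial>lebesgue_on (cball 0 r)) = 0"
    unfolding tested_integrand_def[abs_def] using tested by simp_all
qed

lemma tested_integrand_ge:
  assumes \<phi>_bounds: "0 \<le> \<phi> x" "\<phi> x \<le> 1" and norm_grad_le: "norm (grad \<phi> x) \<le> \<epsilon> * (\<phi> x + \<delta>)"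
    and \<epsilon>_pos: "0 < \<epsilon>" and \<delta>_nonneg: "0 \<le> \<delta>" and h_le: "h1 x \<le> h2 x"
  defines "E \<equiv> (C * (8 * \<epsilon>) powr min 1 (1 / q)) ^ k"
  shows "excess x * \<phi> x / 2 - 2 * \<epsilon> * (E + \<delta>) \<le> tested_integrand \<phi> x"
proof -
  define T where "T = trunc k (transform_diff x)"
  define A where "A = trunc_deriv k (transform_diff x) * (flux_diff x \<bullet> transform_grad x) +
      power_diff x * T - 2 * \<epsilon> * T"
  have T_bounds: "0 \<le> T" "T \<le> 1"
    by (simp_all add: T_def trunc_nonneg trunc_le_1)
  have E_nonneg: "0 \<le> E"
    using C_pos by (simp add: E_def)
  have "\<bar>flux_diff x \<bullet> grad \<phi> x\<bar> \<le> norm (flux_diff x) * norm (grad \<phi> x)"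
    by (rule Cauchy_Schwarz_ineq2)
  also have "\<dots> \<le> 2 * (\<epsilon> * (\<phi> x + \<delta>))"
    using norm_grad_le by (intro mult_mono norm_flux_diff_le) auto
  finally have "T * (- (2 * \<epsilon> * (\<phi> x + \<delta>))) \<le> T * (flux_diff x \<bullet> grad \<phi> x)"
    using T_bounds(1) by (intro mult_left_mono) auto
  moreover have "T * (2 * \<epsilon> * \<delta>) \<le> 2 * \<epsilon> * \<delta>"
    using T_bounds \<epsilon>_pos \<delta>_nonneg by (intro mult_left_le_one_le) auto
  ultimately have "- (2 * \<epsilon> * T * \<phi> x) - 2 * \<epsilon> * \<delta> \<le> T * (flux_diff x \<bullet> grad \<phi> x)"
    by (simp add: algebra_simps)
  moreover have "excess x * \<phi> x / 2 - 2 * \<epsilon> * E \<le> \<phi> x * A"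
  proof -
    have "excess x / 2 - 2 * \<epsilon> * E \<le> A"
      using truncated_flux_bound[OF k_ge_2 K_ge \<epsilon>_pos, of "u x" "v x" "gu x" "gv x"]
      by (simp add: A_def E_def T_def excess_def power_diff_def transform_diff_def
          transform_grad_def flux_diff_def)
    then have "\<phi> x * (excess x / 2 - 2 * \<epsilon> * E) \<le> \<phi> x * A"
      using \<phi>_bounds(1) by (rule mult_left_mono)
    moreover have "\<phi> x * (2 * \<epsilon> * E) \<le> 2 * \<epsilon> * E"
      using \<phi>_bounds \<epsilon>_pos E_nonneg by (intro mult_left_le_one_le) auto
    ultimately show ?thesis
      by (simp add: algebra_simps)
  qed
  moreover have "0 \<le> T * \<phi> x * (h2 x - h1 x)"
    using T_bounds(1) \<phi>_bounds(1) h_le by simp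
  moreover have "tested_integrand \<phi> x = T * (flux_diff x \<bullet> grad \<phi> x) + \<phi> x * A + 2 * \<epsilon> * T * \<phi> x +
      T * \<phi> x * (h2 x - h1 x)"
    by (simp add: tested_integrand_def A_def T_def inner_add_right algebra_simps)
  ultimately show ?thesis
    by (simp add: distrib_left)
qed

lemma integrable_excess_mult:
  assumes \<phi>_bounds: "is_C1 \<phi>" "\<And>x. 0 \<le> \<phi> x" "\<And>x. \<phi> x \<le> 1"
  shows "integrable (lebesgue_on (cball 0 r)) (\<lambda>x. excess x * \<phi> x)"
proof (rule Bochner_Integration.integrable_bound[OF integrable_power_diff])
  show "(\<lambda>x. excess x * \<phi> x) \<in> borel_measurable (lebesgue_on (cball 0 r))"
    by (intro borel_measurable_times measurable_restrict_space1[OF excess_measurable]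
        borel_measurable_integrable continuous_imp_integrable_lebesgue_on_cball
        is_C1_continuous[OF \<phi>_bounds(1)])
  have "\<bar>trunc k (transform_diff x) * \<phi> x\<bar> \<le> 1" for x
    using \<phi>_bounds(2,3) by (simp add: abs_mult abs_of_nonneg trunc_nonneg trunc_le_1 mult_le_one)
  from mult_left_mono[OF this abs_ge_zero]
  have "\<bar>power_diff x\<bar> * \<bar>trunc k (transform_diff x) * \<phi> x\<bar> \<le> \<bar>power_diff x\<bar>" for x
    by simp
  then show "AE x in lebesgue_on (cball 0 r). norm (excess x * \<phi> x) \<le> norm (power_diff x)"
    by (intro AE_I2) (simp add: excess_def abs_mult mult.assoc)
qed

lemma
  assumes R_pos: "0 < R" and \<epsilon>_pos: "0 < \<epsilon>" and m_ge_2: "2 \<le> m"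
  defines "E \<equiv> (C * (8 * \<epsilon>) powr min 1 (1 / q)) ^ k" and "\<delta> \<equiv> (2 * real m / (\<epsilon> * R)) ^ m"
  shows integrable_excess_cutoff: "integrable lebesgue (\<lambda>x. excess x * cutoff m R x)"
    and integral_excess_cutoff_le: "(\<integral>x. excess x * cutoff m R x \<partial>lebesgue) \<le>
      4 * \<epsilon> * (E + \<delta>) * measure lebesgue (cball (0::'a) R)"
proof -
  let ?M = "lebesgue_on (cball (0::'a) R)"
  interpret finite_measure ?M
    by (rule finite_measure_lebesgue_on_cball)
  note supported = cutoff_supported[OF R_pos m_ge_2, where 'a = 'a]
  have vanishing: "excess x * cutoff m R x = 0" if "x \<notin> cball 0 R" for x
    using C1_supported_in_eq_0[OF supported that] by simp
  have integrable: "integrable ?M (\<lambda>x. excess x * cutoff m R x)"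
    by (intro integrable_excess_mult is_C1_cutoff m_ge_2 cutoff_nonneg cutoff_le_1)
  then show "integrable lebesgue (\<lambda>x. excess x * cutoff m R x)"
    using vanishing by (subst (asm) integrable_lebesgue_on_vanishing) auto
  have "(\<integral>x. excess x * cutoff m R x / 2 - 2 * \<epsilon> * (E + \<delta>) \<partial>?M) \<le>
      (\<integral>x. tested_integrand (cutoff m R) x \<partial>?M)"
  proof (rule integral_mono_AE)
    have "AE x in ?M. h1 x \<le> h2 x"
      using h_ordered(3) by (subst AE_restrict_space_iff) (auto elim: eventually_mono)
    then show "AE x in ?M. excess x * cutoff m R x / 2 - 2 * \<epsilon> * (E + \<delta>) \<le>
        tested_integrand (cutoff m R) x"
    proof eventually_elim
      case (elim x)
      show ?case
        unfolding E_def using R_pos \<epsilon>_pos norm_grad_cutoff_le[OF m_ge_2 R_pos \<epsilon>_pos] elim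
        by (intro tested_integrand_ge cutoff_nonneg cutoff_le_1) (auto simp: \<delta>_def)
    qed
  qed (use integrable integrable_tested_integrand[OF supported] in auto)
  also have "\<dots> = 0"
    by (rule integral_tested_integrand[OF supported])
  finally have "(\<integral>x. excess x * cutoff m R x \<partial>?M) \<le>
      4 * \<epsilon> * (E + \<delta>) * measure lebesgue (cball (0::'a) R)"
    using integrable by (simp add: measure_restrict_space algebra_simps)
  then show "(\<integral>x. excess x * cutoff m R x \<partial>lebesgue) \<le>
      4 * \<epsilon> * (E + \<delta>) * measure lebesgue (cball (0::'a) R)"
    using vanishing by (subst (asm) integral_lebesgue_on_vanishing) auto
qed

end

lemma AE_eq_0_if_integrals_tendsto_0:
  fixes F :: "'a \<Rightarrow> real"
  assumes F_nonneg: "F \<in> borel_measurable M" "\<And>x. 0 \<le> F x"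
    and \<phi>_weights: "\<And>n x. 0 \<le> \<phi> n x" "\<And>x. (\<lambda>n. \<phi> n x) \<longlonglongrightarrow> 1"
    and integrable: "\<And>n. integrable M (\<lambda>x. F x * \<phi> n x)"
    and lim: "(\<lambda>n. \<integral>x. F x * \<phi> n x \<partial>M) \<longlonglongrightarrow> 0"
  shows "AE x in M. F x = 0"
proof -
  have "(\<integral>\<^sup>+x. ennreal (F x) \<partial>M) = (\<integral>\<^sup>+x. liminf (\<lambda>n. ennreal (F x * \<phi> n x)) \<partial>M)"
  proof (rule nn_integral_cong)
    fix x
    have "(\<lambda>n. ennreal (F x * \<phi> n x)) \<longlonglongrightarrow> ennreal (F x * 1)"
      by (intro tendsto_ennrealI tendsto_mult_left \<phi>_weights(2))
    then show "ennreal (F x) = liminf (\<lambda>n. ennreal (F x * \<phi> n x))"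
      by (simp add: lim_imp_Liminf)
  qed
  also have "\<dots> \<le> liminf (\<lambda>n. \<integral>\<^sup>+x. ennreal (F x * \<phi> n x) \<partial>M)"
    using integrable by (intro nn_integral_liminf) auto
  also have "\<dots> = liminf (\<lambda>n. ennreal (\<integral>x. F x * \<phi> n x \<partial>M))"
    using integrable F_nonneg(2) \<phi>_weights(1) by (simp add: nn_integral_eq_integral)
  also have "\<dots> = 0"
    using tendsto_ennrealI[OF lim] by (simp add: lim_imp_Liminf)
  finally show ?thesis
    using F_nonneg by (simp add: nn_integral_0_iff_AE)
qed

lemma cutoff_tendsto_1:
  assumes "filterlim R at_top F" shows "((\<lambda>n. cutoff m (R n) x) \<longlongrightarrow> 1) F"
proof -
  have "((\<lambda>n. norm x / R n) \<longlongrightarrow> 0) F"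
    by (rule real_tendsto_divide_at_top[OF tendsto_const assms])
  then have "((\<lambda>n. (max 0 (1 - (norm x / R n)\<^sup>2)) ^ m) \<longlongrightarrow> (max 0 (1 - 0\<^sup>2)) ^ m) F"
    by (intro tendsto_intros)
  then show ?thesis
    by (simp add: cutoff_def)
qed

context comparison_pair
begin

lemma integral_excess_cutoff_le_linear:
  assumes \<epsilon>_bounds: "0 < \<epsilon>" "8 * \<epsilon> \<le> 1" and k_large: "2 * real DIM('a) \<le> min 1 (1 / q) * real k"
  defines "m \<equiv> 2 * DIM('a)"
  shows "(\<integral>x. excess x * cutoff m (1 / \<epsilon>\<^sup>2) x \<partial>lebesgue) \<le>
    4 * unit_ball_vol (real DIM('a)) * (C ^ k * 8 ^ m + (2 * real m) ^ m) * \<epsilon>"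
proof -
  define \<theta> where "\<theta> = min 1 (1 / q)"
  have m_ge_2: "2 \<le> m"
    using DIM_positive[where 'a = 'a] unfolding m_def by linarith
  have "((8 * \<epsilon>) powr \<theta>) ^ k = (8 * \<epsilon>) powr (\<theta> * real k)"
    using \<epsilon>_bounds by (simp add: powr_powr flip: powr_realpow)
  also have "\<dots> \<le> (8 * \<epsilon>) powr real m"
    using \<epsilon>_bounds k_large by (intro powr_mono') (auto simp: m_def \<theta>_def)
  finally have "(C * (8 * \<epsilon>) powr \<theta>) ^ k \<le> C ^ k * 8 ^ m * \<epsilon> ^ m"
    using \<epsilon>_bounds C_pos by (simp add: power_mult_distrib powr_realpow)
  moreover have "(2 * real m / (\<epsilon> * (1 / \<epsilon>\<^sup>2))) ^ m = (2 * real m) ^ m * \<epsilon> ^ m"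
    using \<epsilon>_bounds by (simp add: power2_eq_square power_mult_distrib)
  ultimately have error_le: "(C * (8 * \<epsilon>) powr \<theta>) ^ k + (2 * real m / (\<epsilon> * (1 / \<epsilon>\<^sup>2))) ^ m \<le>
      (C ^ k * 8 ^ m + (2 * real m) ^ m) * \<epsilon> ^ m"
    by (simp add: distrib_right)
  have volume: "measure lebesgue (cball (0::'a) (1 / \<epsilon>\<^sup>2)) = unit_ball_vol (real DIM('a)) / \<epsilon> ^ m"
    using content_cball[of "1 / \<epsilon>\<^sup>2" "0::'a"] by (simp add: m_def power_one_over power_mult)
  have "(\<integral>x. excess x * cutoff m (1 / \<epsilon>\<^sup>2) x \<partial>lebesgue) \<le>
      4 * \<epsilon> * ((C * (8 * \<epsilon>) powr \<theta>) ^ k + (2 * real m / (\<epsilon> * (1 / \<epsilon>\<^sup>2))) ^ m) *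
      measure lebesgue (cball (0::'a) (1 / \<epsilon>\<^sup>2))"
    unfolding \<theta>_def using \<epsilon>_bounds m_ge_2 by (intro integral_excess_cutoff_le) auto
  also have "\<dots> \<le> 4 * \<epsilon> * ((C ^ k * 8 ^ m + (2 * real m) ^ m) * \<epsilon> ^ m) *
      measure lebesgue (cball (0::'a) (1 / \<epsilon>\<^sup>2))"
    using \<epsilon>_bounds error_le by (intro mult_right_mono mult_left_mono) auto
  also have "\<dots> = 4 * unit_ball_vol (real DIM('a)) * (C ^ k * 8 ^ m + (2 * real m) ^ m) * \<epsilon>"
    using \<epsilon>_bounds by (simp add: volume)
  finally show ?thesis .
qed

lemma AE_u_le_v:
  assumes k_large: "2 * real DIM('a) \<le> min 1 (1 / q) * real k"
  shows "AE x in lebesgue. u x \<le> v x"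
proof -
  define m where "m = 2 * DIM('a)"
  define \<epsilon> where "\<epsilon> n = 1 / (8 * real (Suc n))" for n
  define D where "D = 4 * unit_ball_vol (real DIM('a)) * (C ^ k * 8 ^ m + (2 * real m) ^ m)"
  have \<epsilon>_bounds: "0 < \<epsilon> n" "8 * \<epsilon> n \<le> 1" for n
    by (simp_all add: \<epsilon>_def)
  have \<epsilon>_lim: "\<epsilon> \<longlonglongrightarrow> 0"
    using tendsto_mult_right_zero[OF LIMSEQ_inverse_real_of_nat, of "1 / 8"]
    by (simp add: \<epsilon>_def[abs_def] field_simps)
  have m_ge_2: "2 \<le> m"
    using DIM_positive[where 'a = 'a] unfolding m_def by linarith
  have "AE x in lebesgue. excess x = 0"
  proof (rule AE_eq_0_if_integrals_tendsto_0[OF excess_measurable excess_nonneg cutoff_nonneg])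
    have "LIM n sequentially. 1 / (\<epsilon> n)\<^sup>2 :> at_top"
      using \<epsilon>_bounds(1) tendsto_power[OF \<epsilon>_lim, of 2] unfolding divide_inverse mult_1_left
      by (intro filterlim_inverse_at_top always_eventually) (auto simp: less_imp_neq[symmetric])
    then show "(\<lambda>n. cutoff m (1 / (\<epsilon> n)\<^sup>2) x) \<longlonglongrightarrow> 1" for x
      by (rule cutoff_tendsto_1)
    show "integrable lebesgue (\<lambda>x. excess x * cutoff m (1 / (\<epsilon> n)\<^sup>2) x)" for n
      using \<epsilon>_bounds(1)[of n] m_ge_2 by (intro integrable_excess_cutoff) auto
    have "norm (\<integral>x. excess x * cutoff m (1 / (\<epsilon> n)\<^sup>2) x \<partial>lebesgue) \<le> D * \<epsilon> n" for n
      using integral_excess_cutoff_le_linear[OF \<epsilon>_bounds k_large, of n]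
      by (simp add: D_def m_def abs_of_nonneg Bochner_Integration.integral_nonneg excess_nonneg
          cutoff_nonneg)
    then show "(\<lambda>n. \<integral>x. excess x * cutoff m (1 / (\<epsilon> n)\<^sup>2) x \<partial>lebesgue) \<longlonglongrightarrow> 0"
      by (intro Lim_null_comparison[OF always_eventually tendsto_mult_right_zero[OF \<epsilon>_lim]]) auto
  qed
  then show ?thesis
    by eventually_elim (metis excess_pos less_irrefl not_le)
qed

end

theorem comparison_principle:
  fixes u v :: "'a::euclidean_space \<Rightarrow> real"
  assumes q_pos: "0 < q" and u_solves: "solves q h1 u gu" and v_solves: "solves q h2 v gv"
    and h_ordered: "h1 \<in> Lp_loc 1" "h2 \<in> Lp_loc 1" "AE x in lebesgue. h1 x \<le> h2 x"
  shows "AE x in lebesgue. u x \<le> v x"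
proof -
  define \<theta> where "\<theta> = min 1 (1 / q)"
  have \<theta>_pos: "0 < \<theta>" using q_pos by (simp add: \<theta>_def)
  obtain j :: nat where j_large: "2 * real DIM('a) / \<theta> \<le> real j"
    using real_arch_simple by blast
  define k where "k = max 2 j"
  have "2 * real DIM('a) / \<theta> \<le> real k"
    using j_large by (simp add: k_def)
  then have k_large: "2 * real DIM('a) \<le> \<theta> * real k"
    using \<theta>_pos by (simp add: field_simps)
  obtain S \<rho> C where "comparison_transform q (2 * real k) S \<rho> C"
    using comparison_transform_exists[OF q_pos] by blast
  then interpret comparison_pair q "2 * real k" S \<rho> C k u v h1 h2 gu gv
    using u_solves v_solves h_ordered
    by (intro comparison_pair.intro comparison_pair_axioms.intro) (auto simp: k_def)
  show ?thesis
    using AE_u_le_v k_large by (simp add: \<theta>_def)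
qed

subsection \<open>Uniqueness and bounds\<close>

lemma AE_le_esssup_of_AE_bounds:
  fixes M :: "'a measure" and f g :: "'a \<Rightarrow> real"
  assumes bound: "\<And>c. AE x in M. f x \<le> c \<Longrightarrow> AE x in M. g x \<le> c"
    and nonnull: "emeasure M (space M) \<noteq> 0"
  shows "AE x in M. ereal (g x) \<le> esssup M (\<lambda>x. ereal (f x))"
proof (cases "esssup M (\<lambda>x. ereal (f x))")
  case (real c)
  then have "AE x in M. f x \<le> c"
    using esssup_AE[of "\<lambda>x. ereal (f x)" M] by simp
  from bound[OF this] real show ?thesis by simp
next
  case MInf
  then have "AE x in M. False"
    using esssup_AE[of "\<lambda>x. ereal (f x)" M] by simp
  with nonnull show ?thesis by (simp add: AE_iff_null null_sets_def)
qed simp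

lemma AE_essinf_le_of_AE_bounds:
  fixes M :: "'a measure" and f g :: "'a \<Rightarrow> real"
  assumes bound: "\<And>c. AE x in M. c \<le> f x \<Longrightarrow> AE x in M. c \<le> g x"
    and nonnull: "emeasure M (space M) \<noteq> 0"
  shows "AE x in M. essinf M (\<lambda>x. ereal (f x)) \<le> ereal (g x)"
proof -
  have "AE x in M. - g x \<le> c" if "AE x in M. - f x \<le> c" for c
    using bound[of "- c"] that by (simp add: minus_le_iff)
  from AE_le_esssup_of_AE_bounds[where f = "\<lambda>x. - f x" and g = "\<lambda>x. - g x", OF this nonnull]
  show ?thesis
    by (simp add: essinf_def ereal_uminus_le_reorder)
qed

lemma solves_signed_pow_AE_le:
  assumes q_pos: "0 < q" and v_solves: "solves q h v g"
    and h_bound: "h \<in> Lp_loc 1" "AE x in lebesgue. h x \<le> c"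
  shows "AE x in lebesgue. signed_pow q (v x) \<le> c"
proof -
  define b where "b = signed_pow (1 / q) c"
  have signed_pow_b: "signed_pow q b = c"
    using q_pos by (simp add: b_def signed_pow_inverse)
  have "AE x in lebesgue. v x \<le> b"
    using comparison_principle[OF q_pos v_solves const_solves[of q b] h_bound(1) Lp_loc_const]
      h_bound(2) signed_pow_b by simp
  then show ?thesis
    using strict_mono_less_eq[OF signed_pow_strict_mono[OF q_pos], of _ b] signed_pow_b by simp
qed

lemma solves_signed_pow_AE_ge:
  assumes q_pos: "0 < q" and v_solves: "solves q h v g"
    and h_bound: "h \<in> Lp_loc 1" "AE x in lebesgue. c \<le> h x"
  shows "AE x in lebesgue. c \<le> signed_pow q (v x)"
proof -
  define b where "b = signed_pow (1 / q) c"
  have signed_pow_b: "signed_pow q b = c"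
    using q_pos by (simp add: b_def signed_pow_inverse)
  have "AE x in lebesgue. b \<le> v x"
    using comparison_principle[OF q_pos const_solves[of q b] v_solves Lp_loc_const h_bound(1)]
      h_bound(2) signed_pow_b by simp
  then show ?thesis
    using strict_mono_less_eq[OF signed_pow_strict_mono[OF q_pos], of b] signed_pow_b by simp
qed

theorem theorem1p2:
  fixes q :: real and h :: "'a::euclidean_space \<Rightarrow> real"
  assumes "q > 0" and "h \<in> Lp_loc 1"
  shows "(\<forall>u v. weak_solution q h u \<longrightarrow> weak_solution q h v \<longrightarrow> (AE x in lebesgue. u x = v x)) \<and>
    (\<forall>v. weak_solution q h v \<longrightarrow>
      (AE x in lebesgue. essinf lebesgue (\<lambda>y. ereal (h y)) \<le> ereal (signed_pow q (v x)) \<and>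
         ereal (signed_pow q (v x)) \<le> esssup lebesgue (\<lambda>y. ereal (h y))))"
proof (intro conjI allI impI)
  fix u v assume "weak_solution q h u" "weak_solution q h v"
  note solutions = this[THEN weak_solution_imp_solves]
  have "AE x in lebesgue. u x \<le> v x" "AE x in lebesgue. v x \<le> u x"
    using comparison_principle[OF assms(1)] solutions assms(2) by blast+
  then show "AE x in lebesgue. u x = v x"
    by eventually_elim simp
next
  fix v assume "weak_solution q h v"
  note solution = weak_solution_imp_solves[OF this]
  have "emeasure lebesgue (space (lebesgue :: 'a measure)) \<noteq> 0"
    by (simp add: emeasure_lborel_UNIV)
  then have "AE x in lebesgue. essinf lebesgue (\<lambda>y. ereal (h y)) \<le> ereal (signed_pow q (v x))"
    "AE x in lebesgue. ereal (signed_pow q (v x)) \<le> esssup lebesgue (\<lambda>y. ereal (h y))"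
    using solves_signed_pow_AE_ge[OF assms(1) solution assms(2)]
      solves_signed_pow_AE_le[OF assms(1) solution assms(2)]
    by (intro AE_essinf_le_of_AE_bounds AE_le_esssup_of_AE_bounds; blast)+
  then show "AE x in lebesgue. essinf lebesgue (\<lambda>y. ereal (h y)) \<le> ereal (signed_pow q (v x)) \<and>
      ereal (signed_pow q (v x)) \<le> esssup lebesgue (\<lambda>y. ereal (h y))"
    by eventually_elim simp
qed

end
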